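(* Let $g\geq1$. Define $$m_2^g=\sum m_2^g(r),$$ the sum over integers $r\ge0$ with $\frac{2g+1-r}{4}\in\{0,1,2,\dots\}$; $$m_3^g=\sum m_3^g(s,t),$$ the sum over integers $s,t\ge0$ with $\frac{g+1-s-t}{3}\in\{0,1,2,\dots\}$ and $s\equiv 2g+1\pmod 3$; $$m_6^g=\sum m_6^g(3r;2s,2t),$$ the sum over integers $r,s,t\ge0$ with $\frac{2g+5-3r-4s-4t}{12}\in\{0,1,2,\dots\}$ and $2s\equiv 2g+1\pmod 3$. For a positive integer $d$, let $M_d^g$ be the number of equivalence classes of oriented maximal Wicks forms of genus $g$ whose automorphism group has order divisible by $d$. Then $$M_1^g=m_1^g+m_2^g+2m_3^g+2m_6^g,\qquad M_2^g=2m_2^g+4m_6^g,\qquad M_3^g=3m_3^g+3m_6^g,\qquad M_6^g=6m_6^g,$$ and $M_d^g=0$ whenever $d$ is not a divisor of $6$.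
   Context: An oriented Wicks form is a cyclic word $w=w_1w_2\cdots w_{2l}$ over an alphabet $a_1^{\pm1},a_2^{\pm1},\dots$ such that: (1) if $a_i^{\epsilon}$ ($\epsilon\in\{\pm1\}$) appears in $w$, then $a_i^{-\epsilon}$ appears exactly once; (2) no cyclic factor is of the form $a_ia_i^{-1}$ or $a_i^{-1}a_i$; (3) if $a_i^{\epsilon}a_j^{\delta}$ is a cyclic factor, then $a_j^{-\delta}a_i^{-\epsilon}$ is not. Two forms are isomorphic (equivalent) if one is obtained from the other, as cyclic words, by a bijection of alphabets $\varphi$ with $\varphi(a^{-1})=\varphi(a)^{-1}$. Gluing a $2l$-gon labelled by $w$ gives a closed oriented surface $S$ with a graph $\Gamma\subset S$; the genus of $S$ is the genus of $w$. The edges of $\Gamma$ are the letter pairs, and the vertices are the classes of identified corners between consecutive letters. A form of genus $g$ is maximal if its length is $6(2g-1)$; then all vertices of $\Gamma$ have degree $3$. Sign of a vertex $V$ (edges $a,b,c$ oriented toward $V$): $V$ is positive if $w=ab^{-1}\cdots bc^{-1}\cdots ca^{-1}\cdots$ or $w=ac^{-1}\cdots cb^{-1}\cdots ba^{-1}\cdots$. It is negative if $w=ab^{-1}\cdots ca^{-1}\cdots bc^{-1}\cdots$ or $w=ac^{-1}\cdots ba^{-1}\cdots cb^{-1}\cdots$. $\mathrm{Aut}(w)$, for $w=w_1\cdots w_{2e}$, is the group of cyclic shifts $\mu$ of the linear word such that $\mu(w)$ is obtained from $w$ by a bijection $\varphi_\mu$ of the alphabet compatible with inverses. It acts on the edges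 and vertices of $\Gamma$. An edge $\{a,a^{-1}\}$ is reversed if $\varphi_\mu(a)=a^{-1}$. The sets of equivalence classes of oriented maximal Wicks forms of genus $g$ are: - $W_1^g$: all such forms; - $W_2^g(r)$: those with an automorphism of order $2$ reversing exactly $r$ edges; - $W_3^g(s,t)$: those with an automorphism of order $3$ fixing exactly $s$ positive and $t$ negative vertices; - $W_6^g(3r;2s,2t)=W_2^g(3r)\cap W_3^g(2s,2t)$. The mass of a finite set $W$ is $m(W)=\sum_{w\in W}1/|\mathrm{Aut}(w)|$. We write $m_1^g=m(W_1^g)$, $m_2^g(r)=m(W_2^g(r))$, $m_3^g(s,t)=m(W_3^g(s,t))$ and $m_6^g(3r;2s,2t)=m(W_6^g(3r;2s,2t))$. *)

theory Defs
  imports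
    Complex_Main
    "HOL-Algebra.Multiplicative_Group"
    "HOL-Number_Theory.Cong"
begin

text \<open>
  The letter \<open>a\<^sub>i\<close> is \<open>(i, True)\<close> and its inverse is \<open>(i, False)\<close>.  A cyclic word is represented by
  any of its linear words.
\<close>

type_synonym letter = "nat \<times> bool"

fun linv :: "letter \<Rightarrow> letter" where
  "linv (i, e) = (i, \<not> e)"

definition cyclic_factor :: "letter list \<Rightarrow> letter \<Rightarrow> letter \<Rightarrow> bool" where
  "cyclic_factor w x y \<longleftrightarrow>
     (\<exists>i < length w. w ! i = x \<and> w ! (Suc i mod length w) = y)"

definition oriented_wicks_form :: "letter list \<Rightarrow> bool" where
  "oriented_wicks_form w \<longleftrightarrow>
     even (length w) \<and>
     (\<forall>x \<in> set w. count_list w (linv x) = 1) \<and>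
     (\<forall>x. \<not> cyclic_factor w x (linv x)) \<and>
     (\<forall>x y. cyclic_factor w x y \<longrightarrow> \<not> cyclic_factor w (linv y) (linv x))"

definition relabelling :: "(letter \<Rightarrow> letter) \<Rightarrow> letter list \<Rightarrow> letter list \<Rightarrow> bool" where
  "relabelling \<phi> w w' \<longleftrightarrow>
     bij_betw \<phi> (set w) (set w') \<and>
     (\<forall>x \<in> set w. \<phi> (linv x) = linv (\<phi> x)) \<and>
     w' = map \<phi> w"

definition wicks_equiv :: "(letter list \<times> letter list) set" where
  "wicks_equiv = {(w, w'). oriented_wicks_form w \<and> oriented_wicks_form w' \<and>
     (\<exists>k \<phi>. relabelling \<phi> w (rotate k w'))}"

definition wicks_edges :: "letter list \<Rightarrow> letter set set" where
  "wicks_edges w = (\<lambda>x. {x, linv x}) ` set w"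

text \<open>
  Corner \<open>i\<close> of the polygon lies between \<open>w ! i\<close> and the cyclically next letter.  Gluing the side
  \<open>w ! i\<close> to the side carrying its inverse identifies corner \<open>i\<close>, the end point of the former,
  with the start point of the latter, which is the corner just before the inverse letter.
\<close>

definition corner_gluing :: "letter list \<Rightarrow> (nat \<times> nat) set" where
  "corner_gluing w = {(i, j). i < length w \<and> j < length w \<and>
     w ! (Suc j mod length w) = linv (w ! i)}"

definition wicks_vertices :: "letter list \<Rightarrow> nat set set" where
  "wicks_vertices w = {..<length w} // ((corner_gluing w \<union> (corner_gluing w)\<inverse>)\<^sup>*)"

text \<open>
  The glued surface carries a cell structure with a single face, so its Euler characteristic is
  \<open>V - E + 1\<close>; a closed oriented surface has genus \<open>g\<close> iff this equals \<open>2 - 2g\<close>.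
\<close>

definition wicks_euler_char :: "letter list \<Rightarrow> int" where
  "wicks_euler_char w = int (card (wicks_vertices w)) - int (card (wicks_edges w)) + 1"

definition has_genus :: "letter list \<Rightarrow> nat \<Rightarrow> bool" where
  "has_genus w g \<longleftrightarrow> wicks_euler_char w = 2 - 2 * int g"

definition maximal_wicks_forms :: "nat \<Rightarrow> letter list set" where
  "maximal_wicks_forms g = {w. oriented_wicks_form w \<and> has_genus w g \<and>
     int (length w) = 6 * (2 * int g - 1)}"

text \<open>
  The edges oriented toward a vertex \<open>V\<close> are the letters \<open>w ! i\<close> with \<open>i \<in> V\<close>, each of them ending
  at corner \<open>i\<close>.
\<close>

definition letters_toward :: "letter list \<Rightarrow> nat set \<Rightarrow> letter set" where
  "letters_toward w V = (!) w ` V"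

definition cyclic_pattern ::
  "letter list \<Rightarrow> letter list \<Rightarrow> letter list \<Rightarrow> letter list \<Rightarrow> bool" where
  "cyclic_pattern w p q r \<longleftrightarrow> (\<exists>k u v x. rotate k w = p @ u @ q @ v @ r @ x)"

definition positive_vertex :: "letter list \<Rightarrow> nat set \<Rightarrow> bool" where
  "positive_vertex w V \<longleftrightarrow> (\<exists>a b c. letters_toward w V = {a, b, c} \<and>
     (cyclic_pattern w [a, linv b] [b, linv c] [c, linv a] \<or>
      cyclic_pattern w [a, linv c] [c, linv b] [b, linv a]))"

definition negative_vertex :: "letter list \<Rightarrow> nat set \<Rightarrow> bool" where
  "negative_vertex w V \<longleftrightarrow> (\<exists>a b c. letters_toward w V = {a, b, c} \<and>
     (cyclic_pattern w [a, linv b] [c, linv a] [b, linv c] \<or>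
      cyclic_pattern w [a, linv c] [b, linv a] [c, linv b]))"

text \<open>
  The cyclic shift \<open>rotate k\<close> is represented by \<open>k\<close>, taken modulo the length of the word; it sends
  the letter \<open>w ! i\<close> to \<open>w ! ((i + k) mod length w)\<close>.
\<close>

definition wicks_Aut :: "letter list \<Rightarrow> nat monoid" where
  "wicks_Aut w =
     \<lparr>carrier = {k. k < length w \<and> (\<exists>\<phi>. relabelling \<phi> w (rotate k w))},
      monoid.mult = (\<lambda>j k. (j + k) mod length w),
      one = 0\<rparr>"

definition reversed_edges :: "letter list \<Rightarrow> (letter \<Rightarrow> letter) \<Rightarrow> letter set set" where
  "reversed_edges w \<phi> = {e \<in> wicks_edges w. \<exists>x \<in> e. \<phi> x = linv x}"

definition fixed_vertices :: "letter list \<Rightarrow> nat \<Rightarrow> nat set set" where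
  "fixed_vertices w k = {V \<in> wicks_vertices w. (\<lambda>i. (i + k) mod length w) ` V = V}"

definition W1 :: "nat \<Rightarrow> letter list set set" where
  "W1 g = maximal_wicks_forms g // wicks_equiv"

definition W2 :: "nat \<Rightarrow> nat \<Rightarrow> letter list set set" where
  "W2 g r = {w \<in> maximal_wicks_forms g. \<exists>k \<in> carrier (wicks_Aut w). \<exists>\<phi>.
     group.ord (wicks_Aut w) k = 2 \<and> relabelling \<phi> w (rotate k w) \<and>
     card (reversed_edges w \<phi>) = r} // wicks_equiv"

definition W3 :: "nat \<Rightarrow> nat \<Rightarrow> nat \<Rightarrow> letter list set set" where
  "W3 g s t = {w \<in> maximal_wicks_forms g. \<exists>k \<in> carrier (wicks_Aut w).
     group.ord (wicks_Aut w) k = 3 \<and>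
     card {V \<in> fixed_vertices w k. positive_vertex w V} = s \<and>
     card {V \<in> fixed_vertices w k. negative_vertex w V} = t} // wicks_equiv"

text \<open>
  As for \<open>W2\<close> and \<open>W3\<close>, the arguments are the actual numbers of reversed edges and of fixed vertices,
  so that the set for \<open>(3r; 2s, 2t)\<close> is \<open>W6 g (3 * r) (2 * s) (2 * t)\<close>.
\<close>

definition W6 :: "nat \<Rightarrow> nat \<Rightarrow> nat \<Rightarrow> nat \<Rightarrow> letter list set set" where
  "W6 g r s t = W2 g r \<inter> W3 g s t"

definition mass :: "letter list set set \<Rightarrow> real" where
  "mass W = (\<Sum>C \<in> W. 1 / real (order (wicks_Aut (SOME w. w \<in> C))))"

definition m1 :: "nat \<Rightarrow> real" where
  "m1 g = mass (W1 g)"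

definition m2 :: "nat \<Rightarrow> real" where
  "m2 g = (\<Sum>r | (2 * real g + 1 - real r) / 4 \<in> \<nat>. mass (W2 g r))"

definition m3 :: "nat \<Rightarrow> real" where
  "m3 g = (\<Sum>(s, t) | (real g + 1 - real s - real t) / 3 \<in> \<nat> \<and> [s = 2 * g + 1] (mod 3).
     mass (W3 g s t))"

definition m6 :: "nat \<Rightarrow> real" where
  "m6 g = (\<Sum>(r, s, t) | (2 * real g + 5 - 3 * real r - 4 * real s - 4 * real t) / 12 \<in> \<nat> \<and>
     [2 * s = 2 * g + 1] (mod 3). mass (W6 g (3 * r) (2 * s) (2 * t)))"

definition M :: "nat \<Rightarrow> nat \<Rightarrow> nat" where
  "M d g = card ({w \<in> maximal_wicks_forms g. d dvd order (wicks_Aut w)} // wicks_equiv)"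

end

theory Submission
  imports Defs "HOL-Combinatorics.Permutations"
begin

text \<open>
  A maximal form of length \<open>n\<close> amounts to a fixed-point free involution \<open>s\<close> on the residues modulo
  \<open>n\<close> such that \<open>t i = s i - 1\<close> satisfies \<open>t (t (t i)) = i\<close>, and its automorphisms are the rotations
  commuting with \<open>s\<close>. Dividing by a rotation by \<open>N\<close> gives an \<open>N\<close>-gon with a gluing of the same kind,
  where \<open>s\<close> and \<open>t\<close> may have fixed points (reversed edges and fixed vertices).

  The displacements \<open>s i - i\<close>, summed over a period, have a sum \<open>D\<close> with \<open>2 D = 0\<close> modulo \<open>n\<close>; the
  displacements of \<open>t\<close> have the sum \<open>D - N\<close>, and \<open>3 (D - N) = 0\<close>. Hence \<open>n\<close> divides \<open>6 N\<close>, so the order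
  of the automorphism group divides 6. For order 3 the same sums compare the numbers of positive and
  negative fixed vertices modulo 3. That the genus of the quotient is a nonnegative integer follows
  from a spanning tree bound and from the signs of the permutations \<open>s\<close>, \<open>t\<close> and \<open>i + 1\<close>; this shows
  that the index sets of the sums defining \<open>m2\<close>, \<open>m3\<close> and \<open>m6\<close> omit no class. So each of these
  numbers is the mass of all classes whose automorphism group has order divisible by 2, 3 or 6, and
  the identities hold class by class.
\<close>

section \<open>Cubic gluings\<close>

text \<open>Induction on the number of moved points: composing \<open>p\<close> with the
  transposition of \<open>a\<close> and \<open>p a\<close> fixes these two points, changes no other
  value and flips the sign.\<close>

lemma sign_involution:
  assumes "finite A" "p permutes A" "\<And>x. p (p x) = x"
  shows "even (card {x. p x \<noteq> x}) \<and> sign p = (-1) ^ (card {x. p x \<noteq> x} div 2)"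
  using assms(2,3)
proof (induction "card {x. p x \<noteq> x}" arbitrary: p rule: less_induct)
  case less
  have sub: "{x. p x \<noteq> x} \<subseteq> A" if "p permutes A" for p
    using that by (auto simp: permutes_def)
  have fin: "finite {x. p x \<noteq> x}"
    using finite_subset[OF sub[OF less.prems(1)] assms(1)] .
  show ?case
  proof (cases "{x. p x \<noteq> x} = {}")
    case True
    then have "p = id" by auto
    then show ?thesis by simp
  next
    case False
    then obtain a where a: "p a \<noteq> a" by auto
    define q where "q = transpose a (p a) \<circ> p"
    have pp: "p (p x) = x" for x by (rule less.prems(2))
    have pinj: "p x = p y \<longleftrightarrow> x = y" for x y by (metis pp)
    have qv: "q x = (if x = a then a else if x = p a then p a else p x)" for x
    proof -
      have "p x = a \<longleftrightarrow> x = p a" by (metis pp)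
      then show ?thesis unfolding q_def by (auto simp: transpose_def pinj pp)
    qed
    have aA: "a \<in> A" "p a \<in> A"
      using a pp sub[OF less.prems(1)] by auto
    have q_perm: "q permutes A"
      unfolding q_def using aA less.prems(1) by (intro permutes_compose permutes_swap_id)
    have moved: "{x. p x \<noteq> x} = insert a (insert (p a) {x. q x \<noteq> x})"
      using a by (auto simp: qv pp)
    have "finite {x. q x \<noteq> x}" using fin moved by (metis finite_insert)
    then have crd: "card {x. p x \<noteq> x} = Suc (Suc (card {x. q x \<noteq> x}))"
      unfolding moved using a by (simp add: qv)
    have "q (q x) = x" for x
      by (metis qv pp)
    then have IH: "even (card {x. q x \<noteq> x})" "sign q = (-1) ^ (card {x. q x \<noteq> x} div 2)"
      using less.hyps[of q] q_perm crd by auto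
    have "p = transpose a (p a) \<circ> q"
      unfolding q_def by (simp add: fun_eq_iff)
    moreover have "permutation (transpose a (p a))" "permutation q"
      using q_perm assms(1) permutation_permutes by (auto intro: permutation_swap_id)
    ultimately have "sign p = - sign q"
      using a by (metis (no_types) sign_compose sign_swap_id mult_minus1)
    then show ?thesis using IH crd by simp
  qed
qed

text \<open>Serves to replace a count over all sides of a polygon by a count over one period, that
  is, over the sides of a quotient polygon.\<close>

lemma card_periodic:
  fixes P :: "nat \<Rightarrow> bool"
  assumes "\<And>i. P (i + N) \<longleftrightarrow> P i"
  shows "card {i. i < d * N \<and> P i} = d * card {i. i < N \<and> P i}"
proof (induction d)
  case (Suc d)
  have P: "P (i + d * N) \<longleftrightarrow> P i" for i
  proof (induction d)
    case (Suc d)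
    then show ?case using assms[of "i + d * N"] by (simp add: add_ac)
  qed simp
  have "{i. i < Suc d * N \<and> P i} = {i. i < d * N \<and> P i} \<union> (\<lambda>i. i + d * N) ` {i. i < N \<and> P i}"
    (is "?L = ?A \<union> ?B")
  proof (intro Set.set_eqI iffI)
    fix i assume i: "i \<in> ?L"
    show "i \<in> ?A \<union> ?B"
    proof (cases "i < d * N")
      case False
      then have "i = (i - d * N) + d * N" by simp
      moreover have "i - d * N < N" using i False by auto
      moreover have "P (i - d * N)" using i P[of "i - d * N"] False by auto
      ultimately show ?thesis by blast
    qed (use i in auto)
  qed (auto simp: P)
  moreover have "card ?B = card {i. i < N \<and> P i}"
    by (intro card_image inj_onI) auto
  moreover have "card (?A \<union> ?B) = card ?A + card ?B"
    by (rule card_Un_disjoint) auto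
  ultimately show ?case using Suc by simp
qed simp

text \<open>
  Side \<open>i\<close> of an \<open>n\<close>-gon is glued to side \<open>s i\<close>, indices being read modulo \<open>n\<close>; fixed points of \<open>s\<close>
  are sides folded onto themselves, which occur in quotients by rotations. The orbits of \<open>t\<close> are
  the vertices of the glued surface.
\<close>

locale gluing =
  fixes n :: nat and s :: "nat \<Rightarrow> nat"
  assumes s_less: "s i < n"
    and s_mod: "s (i mod n) = s i"
    and s_s: "s (s i) = i mod n"
begin

text \<open>Corner \<open>i\<close> is the end of side \<open>i\<close>, which is glued to the start
  of side \<open>s i\<close>, the corner just before that side. Adding \<open>n - 1\<close>
  subtracts 1 modulo \<open>n\<close> without truncation at 0.\<close>

definition t :: "nat \<Rightarrow> nat" where
  "t i = (s i + (n - 1)) mod n"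

lemma n_pos: "0 < n"
  using s_less[of 0] by simp

lemma t_less: "t i < n"
  by (simp add: t_def n_pos)

lemma t_mod: "t (i mod n) = t i"
  by (simp add: t_def s_mod)

lemma Suc_t: "Suc (t i) mod n = s i"
proof -
  have "Suc (t i) mod n = Suc (s i + (n - 1)) mod n"
    unfolding t_def by (rule mod_Suc_eq)
  also have "Suc (s i + (n - 1)) = s i + n" using n_pos by simp
  finally show ?thesis using s_less by simp
qed

lemma s_cong_mod: "i mod n = j mod n \<Longrightarrow> s i = s j"
  by (metis s_mod)

lemma s_inject: "s i = s j \<longleftrightarrow> i mod n = j mod n"
  by (metis s_s s_mod)

lemma t_inject: "t i = t j \<longleftrightarrow> i mod n = j mod n"
  by (metis Suc_t s_inject t_mod)

lemma t_eq_iff: "t i = j mod n \<longleftrightarrow> s i = Suc j mod n"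
proof
  assume "t i = j mod n"
  then show "s i = Suc j mod n" using Suc_t[of i] by (simp add: mod_Suc_eq)
next
  assume "s i = Suc j mod n"
  then have "t i = (Suc j mod n + (n - 1)) mod n" by (simp add: t_def)
  also have "\<dots> = (Suc j + (n - 1)) mod n" by (rule mod_add_left_eq)
  also have "Suc j + (n - 1) = j + n" using n_pos by simp
  finally show "t i = j mod n" by simp
qed

lemma t_pred: "0 < s i \<Longrightarrow> t i = s i - 1"
  using t_eq_iff[of i "s i - 1"] s_less[of i] by simp

lemma bij_betw_s: "bij_betw s {..<n} {..<n}"
  by (rule bij_betw_byWitness[where f' = s]) (auto simp: s_s s_less)

lemma bij_betw_t: "bij_betw t {..<n} {..<n}"
proof -
  have "inj_on t {..<n}" by (auto simp: inj_on_def t_inject)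
  moreover have "t ` {..<n} \<subseteq> {..<n}" by (auto simp: t_less)
  ultimately show ?thesis
    by (simp add: bij_betw_def endo_inj_surj)
qed

end

text \<open>The condition admits orbits of \<open>t\<close> of size 3 and of size 1. It covers
  trivalent surfaces and also their quotients, where a fixed vertex becomes a corner fixed by
  \<open>t\<close>.\<close>

locale cubic_gluing = gluing +
  assumes t_t_t: "t (t (t i)) = i mod n"
begin

definition loops :: "nat set" where
  "loops = {i. i < n \<and> s i = i}"

definition leaves :: "nat set" where
  "leaves = {i. i < n \<and> t i = i}"

text \<open>One corner of each orbit of size 3, so that
  \<open>card leaves + card orbit_minima\<close> is the number of vertices. The least corner is the
  one at which a walk around the polygon from corner 0 first meets the vertex.\<close>

definition orbit_minima :: "nat set" where
  "orbit_minima = {i. i < n \<and> i < t i \<and> i < t (t i)}"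

lemma sum_orbits:
  fixes h :: "nat \<Rightarrow> 'a::comm_monoid_add"
  shows "sum h {..<n} = sum h leaves + (\<Sum>i\<in>orbit_minima. h i + h (t i) + h (t (t i)))"
proof -
  let ?Q = orbit_minima
  have t3: "t (t (t i)) = i" if "i < n" for i using t_t_t[of i] that by simp
  have inj: "inj_on t ?Q" "inj_on (t \<circ> t) ?Q"
    by (auto simp: inj_on_def orbit_minima_def t_inject t_less)
  have split: "{..<n} = leaves \<union> (?Q \<union> (t ` ?Q \<union> (t \<circ> t) ` ?Q))"
  proof (intro Set.set_eqI iffI)
    fix i assume "i \<in> {..<n}"
    then have i: "i < n" by simp
    have inj_t: "t x = t y \<Longrightarrow> x < n \<Longrightarrow> y < n \<Longrightarrow> x = y" for x y by (simp add: t_inject)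
    show "i \<in> leaves \<union> (?Q \<union> (t ` ?Q \<union> (t \<circ> t) ` ?Q))"
    proof (cases "t i = i")
      case True
      then show ?thesis using i by (simp add: leaves_def)
    next
      case False
      then have "t (t i) \<noteq> t i" "t (t i) \<noteq> i"
        using inj_t[of "t i" i] i t_less t3[OF i] by metis+
      then consider "i < t i" "i < t (t i)" | "t i < i" "t i < t (t i)" | "t (t i) < i" "t (t i) < t i"
        using False by linarith
      then show ?thesis
      proof cases
        case 1
        then show ?thesis using i by (simp add: orbit_minima_def)
      next
        case 2
        then have "t i \<in> ?Q" using t3[OF i] by (simp add: orbit_minima_def t_less)
        moreover have "i = (t \<circ> t) (t i)" using t3[OF i] by simp
        ultimately show ?thesis by blast
      next
        case 3
        then have "t (t i) \<in> ?Q" using t3[OF i] t3[OF t_less, of i] by (simp add: orbit_minima_def t_less)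
        moreover have "i = t (t (t i))" using t3[OF i] by simp
        ultimately show ?thesis by blast
      qed
    qed
  qed (auto simp: leaves_def orbit_minima_def t_less)
  have fin: "finite leaves" "finite ?Q" by (auto simp: leaves_def orbit_minima_def)
  have 1: "leaves \<inter> (?Q \<union> (t ` ?Q \<union> (t \<circ> t) ` ?Q)) = {}"
    by (auto simp: leaves_def orbit_minima_def t_inject t_less)
  have 2: "?Q \<inter> (t ` ?Q \<union> (t \<circ> t) ` ?Q) = {}" 
    by (auto simp: orbit_minima_def t3)
  have 3: "t ` ?Q \<inter> (t \<circ> t) ` ?Q = {}"
    by (auto simp: orbit_minima_def t_inject t_less t3)
  have "sum h {..<n} = sum h leaves + (sum h ?Q + (sum h (t ` ?Q) + sum h ((t \<circ> t) ` ?Q)))"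
    unfolding split using fin 1 2 3 by (simp add: sum.union_disjoint)
  also have "\<dots> = sum h leaves + (\<Sum>i\<in>?Q. h i + h (t i) + h (t (t i)))"
    using sum.reindex[OF inj(1), of h] sum.reindex[OF inj(2), of h]
    by (simp add: sum.distrib add.assoc comp_def)
  finally show ?thesis .
qed

lemma card_orbits: "n = card leaves + 3 * card orbit_minima"
  using sum_orbits[of "\<lambda>_. 1::nat"] by simp

text \<open>
  Walking around the polygon, every vertex but the first is reached for the first time along an edge.
  These edges are pairwise different and are not loops: they form a spanning tree.
\<close>

lemma spanning_tree_bound: "4 * card leaves + 3 * card loops \<le> n + 6"
proof -
  \<comment> \<open>Corner 0 is the least of its orbit; removing it drops the vertex where the walk
    begins. Side \<open>i\<close> for \<open>i\<close> in \<open>P\<close> is the one along which a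
    vertex is first reached.\<close>
  define P where "P = (leaves \<union> orbit_minima) - {0}"
  have fin: "finite leaves" "finite orbit_minima" "finite loops" "finite P"
    by (auto simp: leaves_def orbit_minima_def loops_def P_def)
  have Pi: "0 < i" "i < n" "i \<le> t i" if "i \<in> P" for i
    using that by (auto simp: P_def leaves_def orbit_minima_def)
  have "card leaves + card orbit_minima = card (leaves \<union> orbit_minima)"
    by (rule card_Un_disjoint[symmetric]) (use fin in \<open>auto simp: leaves_def orbit_minima_def\<close>)
  then have cP: "card leaves + card orbit_minima \<le> card P + 1"
    unfolding P_def using card_Suc_Diff1[of "leaves \<union> orbit_minima" 0] fin
    by (cases "0 \<in> leaves \<union> orbit_minima") auto
  have "card (s ` P) = card P"
    by (rule card_image) (auto simp: inj_on_def s_inject Pi(2))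
  \<comment> \<open>If both sides of an edge lay in \<open>P\<close>, then
    \<open>i \<le> t i = s i - 1\<close> read from either side would give \<open>i < s i\<close> and
    \<open>s i < i\<close>. The subtraction is genuine because 0 is not in \<open>P\<close>.\<close>
  moreover have "P \<inter> s ` P = {}"
  proof (intro equals0I)
    fix i assume "i \<in> P \<inter> s ` P"
    then obtain j where "j \<in> P" "i = s j" "i \<in> P" by auto
    moreover from this have "s i = j" using s_s[of j] Pi[of j] by simp
    ultimately show False
      using Pi[of i] Pi[of j] t_pred[of i] t_pred[of j] by auto
  qed
  moreover have "(P \<union> s ` P) \<inter> loops = {}"
  proof -
    have "s i \<noteq> i" if "i \<in> P" for i using Pi[OF that] t_pred[of i] by auto
    then show ?thesis by (auto simp: loops_def s_s dest: Pi) (metis Pi(2) mod_less s_s)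
  qed
  ultimately have "card (P \<union> s ` P \<union> loops) = 2 * card P + card loops"
    using fin by (simp add: card_Un_disjoint)
  moreover have "card (P \<union> s ` P \<union> loops) \<le> card {..<n}"
    by (rule card_mono) (auto simp: loops_def s_less dest: Pi)
  \<comment> \<open>Triple \<open>2 * card P + card loops \<le> n\<close>; here
    \<open>card P\<close> is at least the number of vertices minus 1, and
    \<open>n = card leaves + 3 * card orbit_minima\<close>.\<close>
  ultimately show ?thesis using cP card_orbits by simp
qed

text \<open>The rotation by 1 has odd order \<open>n\<close> and \<open>t\<close> has order dividing
  3, so both are even permutations, and so is their composition \<open>s\<close>. An even involution
  moves a number of points divisible by 4; the other sides are loops.\<close>

lemma loops_parity:
  assumes "odd n"
  shows "[card loops = n] (mod 4)"
proof -
  \<comment> \<open>Signs are taken of permutations of all naturals, so the three maps are continued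
    by the identity outside the polygon.\<close>
  define S where "S x = (if x < n then s x else x)" for x
  define T where "T x = (if x < n then t x else x)" for x
  define R where "R x = (if x < n then Suc x mod n else x)" for x
  have perm: "F permutes {..<n}" if "bij_betw f {..<n} {..<n}" "F = (\<lambda>x. if x < n then f x else x)"
    for f F :: "nat \<Rightarrow> nat"
  proof (rule bij_imp_permutes)
    show "bij_betw F {..<n} {..<n}" using that bij_betw_cong[of "{..<n}" F f] by simp
  qed (use that in auto)
  have R_pow: "(R ^^ k) x = (if x < n then (x + k) mod n else x)" for k x
  proof (induction k)
    case (Suc k)
    then show ?case using n_pos by (simp add: R_def mod_Suc_eq)
  qed auto
  have R_id: "R ^^ n = id" by (auto simp: R_pow)
  have "inj_on (\<lambda>x. Suc x mod n) {..<n}"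
    by (auto simp: inj_on_def mod_Suc split: if_splits)
  then have "bij_betw (\<lambda>x. Suc x mod n) {..<n} {..<n}"
    using n_pos by (intro bij_betw_imageI endo_inj_surj) auto
  then have R_perm: "R permutes {..<n}" by (rule perm) (simp add: R_def fun_eq_iff)
  have S_perm: "S permutes {..<n}" by (rule perm[OF bij_betw_s]) (simp add: S_def fun_eq_iff)
  have T_perm: "T permutes {..<n}" by (rule perm[OF bij_betw_t]) (simp add: T_def fun_eq_iff)
  have perms: "permutation R" "permutation T"
    using R_perm T_perm permutation_permutes by blast+
  have pow: "permutation (R ^^ k) \<and> sign (R ^^ k) = sign R ^ k" for k
    by (induction k) (simp_all only: funpow.simps power.simps sign_id permutation_id perms
      sign_compose permutation_compose simp_thms)
  have "sign R = 1"
    using pow[of n] R_id assms by (cases R rule: sign_cases) auto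
  moreover have "T \<circ> (T \<circ> T) = id"
    by (auto simp: T_def t_less t_t_t)
  then have "sign T * (sign T * sign T) = 1"
    using perms by (metis sign_compose sign_id permutation_compose)
  then have "sign T = 1" by simp
  moreover have "S = R \<circ> T"
    by (auto simp: S_def T_def R_def t_less Suc_t)
  ultimately have "sign S = 1" using perms by (simp add: sign_compose)
  moreover have "even (card {x. S x \<noteq> x}) \<and> sign S = (-1) ^ (card {x. S x \<noteq> x} div 2)"
    by (rule sign_involution[OF _ S_perm]) (auto simp: S_def s_s s_less)
  ultimately have "even (card {x. S x \<noteq> x})" "even (card {x. S x \<noteq> x} div 2)"
    by (auto simp: minus_one_power_iff split: if_splits)
  then have "4 dvd card {x. S x \<noteq> x}" by presburger
  moreover have "{..<n} = {x. S x \<noteq> x} \<union> loops" "{x. S x \<noteq> x} \<inter> loops = {}"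
    by (auto simp: S_def loops_def split: if_splits)
  then have "n = card {x. S x \<noteq> x} + card loops"
    by (metis card_Un_disjoint card_lessThan finite_Un finite_lessThan)
  ultimately show ?thesis by (metis cong_add_lcancel_0_nat cong_sym cong_0_iff add.commute)
qed

end

section \<open>Rotations of a gluing\<close>

text \<open>Rotation by \<open>N\<close> preserves the gluing and generates a group of order
  \<open>n div N\<close>; \<open>N\<close> consecutive sides form a fundamental domain.\<close>

locale shifted_cubic_gluing = cubic_gluing +
  fixes N :: nat
  assumes N_dvd: "N dvd n"
    and s_shift: "s (i + N) = (s i + N) mod n"
begin

lemma N_pos: "0 < N"
  using N_dvd n_pos by (auto intro: gr0I)

lemma mod_mod_N [simp]: "i mod n mod N = i mod N"
  using N_dvd by (simp add: mod_mod_cancel)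

lemma t_shift: "t (i + N) = (t i + N) mod n"
proof -
  have "s (i + N) = Suc (t i + N) mod n"
    using s_shift[of i] Suc_t[of i] by (metis mod_add_left_eq add_Suc)
  then show ?thesis using t_eq_iff by metis
qed

lemma s_shift_mult: "s (i + k * N) = (s i + k * N) mod n"
proof (induction k)
  case (Suc k)
  then show ?case using s_shift[of "i + k * N"] by (simp add: add_ac mod_simps)
qed (simp add: s_less)

lemma t_shift_mult: "t (i + k * N) = (t i + k * N) mod n"
proof (induction k)
  case (Suc k)
  then show ?case using t_shift[of "i + k * N"] by (simp add: add_ac mod_simps)
qed (simp add: t_less)

lemma s_mod_N: "s (i mod N) mod N = s i mod N"
proof -
  have "s i mod N = s (i mod N + (i div N) * N) mod N" by simp
  also have "\<dots> = s (i mod N) mod N" unfolding s_shift_mult by simp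
  finally show ?thesis by simp
qed

lemma t_mod_N: "t (i mod N) mod N = t i mod N"
proof -
  have "t i mod N = t (i mod N + (i div N) * N) mod N" by simp
  also have "\<dots> = t (i mod N) mod N" unfolding t_shift_mult by simp
  finally show ?thesis by simp
qed

lemma quotient_gluing: "gluing N (\<lambda>i. s i mod N)"
  by unfold_locales (auto simp: N_pos s_mod_N s_s)

lemma quotient_t: "gluing.t N (\<lambda>i. s i mod N) i = t i mod N"
proof -
  interpret q: gluing N "\<lambda>i. s i mod N" by (rule quotient_gluing)
  have "s i mod N = Suc (t i) mod N"
    using Suc_t[of i] mod_mod_N by metis
  then show ?thesis using q.t_eq_iff[of i "t i"] by simp
qed

text \<open>The quotient surface. Its loops are sides glued to a rotation image of themselves, its
  leaves are corners that \<open>t\<close> sends to a rotation image of themselves.\<close>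

sublocale quot: cubic_gluing N "\<lambda>i. s i mod N"
  rewrites "gluing.t N (\<lambda>i. s i mod N) = (\<lambda>i. t i mod N)"
proof -
  interpret q: gluing N "\<lambda>i. s i mod N" by (rule quotient_gluing)
  show "cubic_gluing N (\<lambda>i. s i mod N)"
    by unfold_locales (simp add: quotient_t t_mod_N t_t_t)
  show "gluing.t N (\<lambda>i. s i mod N) = (\<lambda>i. t i mod N)"
    by (simp add: fun_eq_iff quotient_t)
qed

section \<open>Sums of displacements modulo the length\<close>

text \<open>\<open>h\<close> has period \<open>N\<close> modulo \<open>n\<close>, so its sum over a
  period depends, modulo \<open>n\<close>, only on the residues modulo \<open>N\<close> that the
  indices run through.\<close>

lemma sum_reindex_cong:
  fixes h :: "nat \<Rightarrow> int"
  assumes "\<And>i. [h (i + N) = h i] (mod int n)"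
    and "bij_betw (\<lambda>i. p i mod N) {..<N} {..<N}"
  shows "[(\<Sum>i<N. h (p i)) = (\<Sum>i<N. h i)] (mod int n)"
proof -
  have mult: "[h (i + k * N) = h i] (mod int n)" for i k
  proof (induction k)
    case (Suc k)
    then show ?case using assms(1)[of "i + k * N"] by (simp add: add_ac) (metis cong_trans)
  qed simp
  have "[h (p i) = h (p i mod N)] (mod int n)" for i
    using mult[of "p i mod N" "p i div N"] by simp
  then have "[(\<Sum>i<N. h (p i)) = (\<Sum>i<N. h (p i mod N))] (mod int n)"
    by (intro cong_sum) auto
  also have "(\<Sum>i<N. h (p i mod N)) = (\<Sum>i<N. h i)"
    by (rule sum.reindex_bij_betw[OF assms(2)])
  finally show ?thesis .
qed

definition displacement :: "nat \<Rightarrow> int" where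
  "displacement i = int (s i) - int i"

definition turn :: "nat \<Rightarrow> int" where
  "turn i = int (t i) - int i"

lemma int_mod_cong: "[int (i mod n) = int i] (mod int n)"
  by (simp add: cong_def zmod_int)

lemma displacement_shift: "[displacement (i + N) = displacement i] (mod int n)"
proof -
  have "[int (s (i + N)) = int (s i + N)] (mod int n)"
    using int_mod_cong s_shift by metis
  then have "[int (s (i + N)) - int (i + N) = int (s i + N) - int (i + N)] (mod int n)"
    by (intro cong_diff) auto
  then show ?thesis by (simp add: displacement_def)
qed

lemma turn_shift: "[turn (i + N) = turn i] (mod int n)"
proof -
  have "[int (t (i + N)) = int (t i + N)] (mod int n)"
    using int_mod_cong t_shift by metis
  then have "[int (t (i + N)) - int (i + N) = int (t i + N) - int (i + N)] (mod int n)"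
    by (intro cong_diff) auto
  then show ?thesis by (simp add: turn_def)
qed

lemma turn_t_shift: "[turn (t (i + N)) = turn (t i)] (mod int n)"
proof -
  have "[turn (j mod n) = turn j] (mod int n)" for j
    unfolding turn_def t_mod by (intro cong_diff int_mod_cong) auto
  then have "[turn (t (i + N)) = turn (t i + N)] (mod int n)"
    by (simp add: t_shift)
  then show ?thesis using turn_shift cong_trans by blast
qed

lemma turn_displacement: "[turn i = displacement i - 1] (mod int n)"
proof -
  have "[int (s i) = int (Suc (t i))] (mod int n)"
    using int_mod_cong[of "Suc (t i)"] by (simp add: Suc_t)
  then have "[displacement i - 1 = int (Suc (t i)) - int i - 1] (mod int n)"
    unfolding displacement_def by (intro cong_diff) auto
  then show ?thesis by (simp add: turn_def cong_sym_eq)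
qed

lemma turn_orbit: "[turn i + turn (t i) + turn (t (t i)) = 0] (mod int n)"
  using cong_diff[OF int_mod_cong cong_refl, of i "int i"] by (simp add: turn_def t_t_t)

lemma sum_turn: "[(\<Sum>i<N. turn i) = (\<Sum>i<N. displacement i) - int N] (mod int n)"
proof -
  have "[(\<Sum>i<N. turn i) = (\<Sum>i<N. displacement i - 1)] (mod int n)"
    by (intro cong_sum turn_displacement)
  then show ?thesis by (simp add: sum_subtractf)
qed

text \<open>A side and its partner have opposite displacements, and \<open>s\<close> permutes the
  sides of the quotient; so the sum is its own negative modulo \<open>n\<close>.\<close>

lemma sum_displacement: "[2 * (\<Sum>i<N. displacement i) = 0] (mod int n)"
proof -
  have "[displacement i + displacement (s i) = 0] (mod int n)" for i
    using cong_diff[OF int_mod_cong cong_refl, of i "int i"] by (simp add: displacement_def s_s)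
  then have "[(\<Sum>i<N. displacement i + displacement (s i)) = (\<Sum>i<N. 0)] (mod int n)"
    by (intro cong_sum)
  then have "[(\<Sum>i<N. displacement i) + (\<Sum>i<N. displacement (s i)) = 0] (mod int n)"
    by (simp add: sum.distrib)
  moreover have "[(\<Sum>i<N. displacement (s i)) = (\<Sum>i<N. displacement i)] (mod int n)"
    by (intro sum_reindex_cong displacement_shift quot.bij_betw_s)
  ultimately show ?thesis
    by (metis (no_types, lifting) cong_add cong_refl cong_sym cong_trans mult_2)
qed

text \<open>The turns at \<open>i\<close>, \<open>t i\<close> and \<open>t (t i)\<close> cancel, and
  summing any one of the three over a period gives the same value modulo \<open>n\<close>.\<close>

lemma sum_turn_3: "[3 * (\<Sum>i<N. turn i) = 0] (mod int n)"
proof -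
  let ?T = "\<Sum>i<N. turn i"
  have "[(\<Sum>i<N. turn i + turn (t i) + turn (t (t i))) = (\<Sum>i<N. 0)] (mod int n)"
    by (intro cong_sum turn_orbit)
  then have 0: "[?T + (\<Sum>i<N. turn (t i)) + (\<Sum>i<N. turn (t (t i))) = 0] (mod int n)"
    by (simp add: sum.distrib)
  have 1: "[(\<Sum>i<N. turn (t i)) = ?T] (mod int n)"
    by (intro sum_reindex_cong turn_shift quot.bij_betw_t)
  have 2: "[(\<Sum>i<N. turn (t (t i))) = (\<Sum>i<N. turn (t i))] (mod int n)"
    by (intro sum_reindex_cong[where h = "\<lambda>i. turn (t i)"] turn_t_shift quot.bij_betw_t)
  have "[?T + (\<Sum>i<N. turn (t i)) + (\<Sum>i<N. turn (t (t i))) = ?T + ?T + ?T] (mod int n)"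
    using 1 2 by (intro cong_add cong_refl) (auto intro: cong_trans)
  then show ?thesis using 0 cong_trans[OF cong_sym] by fastforce
qed

lemma shift_order_dvd_6: "n dvd 6 * N"
proof -
  let ?D = "\<Sum>i<N. displacement i" and ?T = "\<Sum>i<N. turn i"
  have "int n dvd ?T - (?D - int N)" "int n dvd 2 * ?D" "int n dvd 3 * ?T"
    using sum_turn sum_displacement sum_turn_3 by (auto simp: cong_iff_dvd_diff)
  \<comment> \<open>The coefficients are chosen so that both sums cancel and \<open>6 * N\<close> is
    left.\<close>
  then have "int n dvd 6 * (?T - (?D - int N)) + 3 * (2 * ?D) - 2 * (3 * ?T)"
    by (meson dvd_add dvd_diff dvd_mult)
  then have "int n dvd int (6 * N)" by (simp add: algebra_simps)
  then show ?thesis by (simp only: int_dvd_int_iff)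
qed

text \<open>In the sum of turns over a period the orbits of size 3 cancel, while a leaf contributes
  \<open>N\<close> or \<open>2 * N\<close>. Comparison with the sum of displacements, which vanishes
  modulo \<open>n\<close>, relates the numbers of the two kinds of leaves modulo 3.\<close>

lemma signed_leaves:
  assumes n: "n = 3 * N" and free: "\<And>i. t i \<noteq> i mod n"
  shows "[int (card {i. i < N \<and> t i = (i + N) mod n}) + 1
    = int (card {i. i < N \<and> t i = (i + 2 * N) mod n})] (mod 3)"
    and "card quot.leaves = card {i. i < N \<and> t i = (i + N) mod n}
      + card {i. i < N \<and> t i = (i + 2 * N) mod n}"
proof -
  define A where "A = {i. i < N \<and> t i = (i + N) mod n}"
  define B where "B = {i. i < N \<and> t i = (i + 2 * N) mod n}"
  have fin: "finite A" "finite B" by (auto simp: A_def B_def)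
  have AB: "A = {i. i < N \<and> t i = i + N}" "B = {i. i < N \<and> t i = i + 2 * N}"
    using n by (auto simp: A_def B_def)
  have disj: "A \<inter> B = {}" using N_pos by (auto simp: AB)
  have "quot.leaves = A \<union> B"
  proof (intro Set.set_eqI iffI)
    fix i assume "i \<in> quot.leaves"
    then have i: "i < N" "t i mod N = i" by (auto simp: quot.leaves_def)
    have "t i div N < 3" using t_less[of i] n by (simp add: less_mult_imp_div_less)
    moreover have "t i div N \<noteq> 0" 
    proof
      assume "t i div N = 0"
      then have "t i = i" using div_mult_mod_eq[of "t i" N] i by simp
      then show False using free[of i] t_less[of i] by simp
    qed
    ultimately have "t i div N = 1 \<or> t i div N = 2" by linarith
    then show "i \<in> A \<union> B"
      using div_mult_mod_eq[of "t i" N] i by (auto simp: AB)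
  qed (auto simp: AB quot.leaves_def)
  then show "card quot.leaves = card {i. i < N \<and> t i = (i + N) mod n}
      + card {i. i < N \<and> t i = (i + 2 * N) mod n}"
    using fin disj by (simp add: card_Un_disjoint A_def[symmetric] B_def[symmetric])
  let ?D = "\<Sum>i<N. displacement i" and ?T = "\<Sum>i<N. turn i"
  \<comment> \<open>The quotient reads corners modulo \<open>N\<close>, which changes no turn modulo
    \<open>n\<close>.\<close>
  have modN: "[turn (t i mod N) = turn (t i)] (mod int n)"
    "[turn (t (t i mod N) mod N) = turn (t (t i))] (mod int n)" for i
  proof -
    have mult: "[turn (i + k * N) = turn i] (mod int n)" for i k
    proof (induction k)
      case (Suc k)
      then show ?case using turn_shift[of "i + k * N"] by (simp add: add_ac) (metis cong_trans)
    qed simp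
    have *: "[turn (j mod N) = turn j] (mod int n)" for j
      using mult[of "j mod N" "j div N"] by (simp add: cong_sym_eq)
    show "[turn (t i mod N) = turn (t i)] (mod int n)" by (rule *)
    have "t (t i mod N) mod N = t (t i) mod N" by (rule t_mod_N)
    then show "[turn (t (t i mod N) mod N) = turn (t (t i))] (mod int n)" using * by simp
  qed
  have "[(\<Sum>i\<in>quot.orbit_minima. turn i + turn (t i mod N) + turn (t (t i mod N) mod N))
      = (\<Sum>i\<in>quot.orbit_minima. 0)] (mod int n)"
  proof (intro cong_sum)
    fix i
    have "[turn i + turn (t i mod N) + turn (t (t i mod N) mod N)
      = turn i + turn (t i) + turn (t (t i))] (mod int n)"
      by (intro cong_add modN cong_refl)
    then show "[turn i + turn (t i mod N) + turn (t (t i mod N) mod N) = 0] (mod int n)"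
      using turn_orbit cong_trans by blast
  qed
  then have "[?T = sum turn quot.leaves + 0] (mod int n)"
    unfolding quot.sum_orbits[of turn] by (intro cong_add cong_refl) simp
  moreover have "sum turn quot.leaves = (\<Sum>i\<in>A. int N) + (\<Sum>i\<in>B. 2 * int N)"
    unfolding \<open>quot.leaves = A \<union> B\<close> sum.union_disjoint[OF fin disj]
    by (intro arg_cong2[where f = "(+)"] sum.cong) (auto simp: AB turn_def)
  ultimately have T: "int n dvd ?T - int N * (int (card A) + 2 * int (card B))"
    by (simp add: cong_iff_dvd_diff algebra_simps)
  \<comment> \<open>Modulo \<open>N\<close> the displacements cancel, as \<open>s\<close> permutes
    the residues. So \<open>?D\<close> is \<open>N * x\<close>, and \<open>2 * ?D = 0\<close> modulo
    \<open>3 * N\<close> makes \<open>x\<close> a multiple of 3.\<close>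
  have "(\<Sum>i<N. int (s i mod N)) = (\<Sum>i<N. int i)"
    by (rule sum.reindex_bij_betw[OF quot.bij_betw_s])
  moreover have "[?D = (\<Sum>i<N. int (s i mod N) - int i)] (mod int N)"
    unfolding displacement_def by (intro cong_sum cong_diff cong_refl) (simp add: cong_def zmod_int)
  ultimately have "int N dvd ?D" by (simp add: cong_iff_dvd_diff sum_subtractf)
  then obtain x where x: "?D = int N * x" by blast
  have N3: "int n dvd int N * y \<longleftrightarrow> 3 dvd y" for y
    using n N_pos by (simp add: mult.commute[of 3] dvd_mult_cancel_left)
  have "int n dvd int N * (2 * x)"
    using sum_displacement x by (simp add: cong_0_iff mult.left_commute)
  then have x3: "3 dvd 2 * x" using N3 by blast
  have "int n dvd ?T - (?D - int N)" using sum_turn by (simp add: cong_iff_dvd_diff)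
  then have "int n dvd (?T - (?D - int N)) - (?T - int N * (int (card A) + 2 * int (card B)))"
    using T by (rule dvd_diff)
  moreover have "(?T - (?D - int N)) - (?T - int N * (int (card A) + 2 * int (card B)))
    = int N * (int (card A) + 2 * int (card B) + 1 - x)"
    by (simp add: x algebra_simps)
  ultimately have "3 dvd int (card A) + 2 * int (card B) + 1 - x" using N3 by metis
  then have "3 dvd int (card A) + 1 - int (card B)" using x3 by presburger
  then show "[int (card {i. i < N \<and> t i = (i + N) mod n}) + 1
    = int (card {i. i < N \<and> t i = (i + 2 * N) mod n})] (mod 3)"
    by (simp add: cong_iff_dvd_diff A_def B_def)
qed

end

section \<open>Wicks forms as gluings\<close>

lemma linv_linv [simp]: "linv (linv x) = x"
  by (cases x) auto

lemma linv_neq [simp]: "linv x \<noteq> x"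
  by (cases x) auto

lemma linv_inject [simp]: "linv x = linv y \<longleftrightarrow> x = y"
  by (metis linv_linv)

text \<open>Read modulo the length, so that it is defined on all naturals as \<open>gluing\<close>
  demands. \<open>THE\<close> is justified by \<open>distinct_word\<close>.\<close>

definition partner :: "letter list \<Rightarrow> nat \<Rightarrow> nat" where
  "partner w i = (THE j. j < length w \<and> w ! j = linv (w ! (i mod length w)))"

abbreviation corner_succ :: "letter list \<Rightarrow> nat \<Rightarrow> nat" where
  "corner_succ w \<equiv> gluing.t (length w) (partner w)"

locale wicks_word =
  fixes w :: "letter list"
  assumes form: "oriented_wicks_form w" and nonempty: "w \<noteq> []"
begin

abbreviation n :: nat where "n \<equiv> length w"

abbreviation letter_at :: "nat \<Rightarrow> letter" where "letter_at i \<equiv> w ! (i mod n)"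

lemma length_pos: "0 < n"
  using nonempty by simp

lemma linv_in_set: "x \<in> set w \<Longrightarrow> linv x \<in> set w"
  using form count_list_0_iff[of w "linv x"] by (auto simp: oriented_wicks_form_def)

text \<open>The counting clause, applied to the inverse of a letter, counts the letter
  itself.\<close>

lemma distinct_word: "distinct w"
proof -
  have "count_list w x = 1" if "x \<in> set w" for x
    using form linv_in_set[OF that] by (metis linv_linv oriented_wicks_form_def)
  then show ?thesis
    by (auto simp: distinct_count_atmost_1 count_mset)
qed

lemma letter_at_in_set: "letter_at i \<in> set w"
  using length_pos by simp

lemma letter_at_eq_iff: "letter_at i = letter_at j \<longleftrightarrow> i mod n = j mod n"
  using distinct_word length_pos by (simp add: nth_eq_iff_index_eq)

lemma partner_props: "partner w i < n \<and> w ! partner w i = linv (letter_at i)"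
proof -
  obtain j where j: "j < n" "w ! j = linv (letter_at i)"
    using linv_in_set[OF letter_at_in_set] by (metis in_set_conv_nth)
  show ?thesis unfolding partner_def
    by (rule theI[of _ j]) (use j distinct_word nth_eq_iff_index_eq in \<open>blast, metis\<close>)
qed

lemma partner_less: "partner w i < n"
  using partner_props by blast

lemma letter_at_partner: "letter_at (partner w i) = linv (letter_at i)"
  using partner_props by simp

lemma partner_eq_iff: "partner w i = j mod n \<longleftrightarrow> letter_at j = linv (letter_at i)"
  using letter_at_eq_iff[of j "partner w i"] letter_at_partner[of i] partner_less[of i] by auto

lemma partner_neq: "partner w i \<noteq> i mod n"
  using partner_eq_iff[of i i] linv_neq[of "letter_at i"] by metis

sublocale gluing "length w" "partner w"
proof
  fix i
  show "partner w i < n" by (rule partner_less)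
  show "partner w (i mod n) = partner w i" by (simp add: partner_def)
  show "partner w (partner w i) = i mod n"
    using partner_eq_iff[of "partner w i" i] letter_at_partner[of i] by simp
qed

lemma t_eq_iff_letter: "t i = j mod n \<longleftrightarrow> letter_at (Suc j) = linv (letter_at i)"
  by (simp add: t_eq_iff partner_eq_iff)

lemma letter_at_Suc_t: "letter_at (Suc (t i)) = linv (letter_at i)"
  using t_eq_iff_letter[of i "t i"] t_less[of i] by simp

lemma cyclic_factor_letter_at: "cyclic_factor w (letter_at i) (letter_at (Suc i))"
proof -
  have "i mod n < n" using length_pos by simp
  moreover have "Suc (i mod n) mod n = Suc i mod n" by (rule mod_Suc_eq)
  ultimately show ?thesis unfolding cyclic_factor_def by metis
qed

text \<open>A vertex of degree 1 would show up as a cyclic factor consisting of a letter and its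
  inverse.\<close>

lemma t_neq: "t i \<noteq> i mod n"
proof
  assume "t i = i mod n"
  then have "letter_at (Suc i) = linv (letter_at i)" by (simp add: t_eq_iff_letter)
  then show False
    using form cyclic_factor_letter_at[of i] by (metis oriented_wicks_form_def)
qed

text \<open>A vertex of degree 2 would show up as a factor \<open>x\<close>, \<open>y\<close>
  together with a factor \<open>linv y\<close>, \<open>linv x\<close>.\<close>

lemma t_t_neq: "t (t i) \<noteq> i mod n"
proof
  assume "t (t i) = i mod n"
  then have "letter_at (Suc i) = linv (letter_at (t i))" by (simp add: t_eq_iff_letter)
  then have "linv (letter_at (Suc i)) = letter_at (t i)" by simp
  moreover have "cyclic_factor w (letter_at (t i)) (linv (letter_at i))"
    using cyclic_factor_letter_at[of "t i"] letter_at_Suc_t[of i] by simp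
  ultimately show False
    using form cyclic_factor_letter_at[of i] by (metis oriented_wicks_form_def)
qed

lemma card_edges: "2 * card (wicks_edges w) = n"
proof -
  have "2 * card (wicks_edges w) = card (\<Union> (wicks_edges w))"
  proof (rule card_partition)
    show "card e = 2" if e: "e \<in> wicks_edges w" for e
    proof -
      obtain x where "e = {x, linv x}" using e by (auto simp: wicks_edges_def)
      then show ?thesis using linv_neq[of x] by (metis card_2_iff)
    qed
    show "c1 \<inter> c2 = {}" if c: "c1 \<in> wicks_edges w" "c2 \<in> wicks_edges w" "c1 \<noteq> c2" for c1 c2
    proof -
      obtain x y where xy: "c1 = {x, linv x}" "c2 = {y, linv y}" using c by (auto simp: wicks_edges_def)
      have "x \<noteq> y" "x \<noteq> linv y" using c(3) xy by auto
      then show ?thesis unfolding xy by auto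
    qed
  qed (auto simp: wicks_edges_def)
  also have "\<Union> (wicks_edges w) = set w"
    using linv_in_set by (fastforce simp: wicks_edges_def simp del: linv.simps)
  finally show ?thesis by (simp add: distinct_card distinct_word)
qed

section \<open>Vertices as orbits of \<open>t\<close>\<close>

definition same_vertex :: "(nat \<times> nat) set" where
  "same_vertex = (corner_gluing w \<union> (corner_gluing w)\<inverse>)\<^sup>*"

lemma corner_gluing_iff: "(i, j) \<in> corner_gluing w \<longleftrightarrow> i < n \<and> j = t i"
proof -
  have "(i, j) \<in> corner_gluing w \<longleftrightarrow> i < n \<and> j < n \<and> t i = j"
    using t_eq_iff_letter[of i j] by (auto simp: corner_gluing_def)
  then show ?thesis using t_less by auto
qed

lemma equiv_same_vertex: "equiv UNIV same_vertex"
  unfolding same_vertex_def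
  by (intro equivI refl_rtrancl sym_rtrancl trans_rtrancl sym_Un_converse subset_UNIV) auto

lemma same_vertex_t: "i < n \<Longrightarrow> (i, t i) \<in> same_vertex"
  unfolding same_vertex_def by (auto simp: corner_gluing_iff)

lemma same_vertex_less: "(i, j) \<in> same_vertex \<Longrightarrow> i < n \<Longrightarrow> j < n"
  unfolding same_vertex_def
  by (induction rule: rtrancl_induct) (auto simp: corner_gluing_iff t_less)

lemma wicks_vertices_eq: "wicks_vertices w = {..<n} // same_vertex"
  by (simp add: wicks_vertices_def same_vertex_def)

lemma same_vertex_refl: "(i, i) \<in> same_vertex"
  by (simp add: same_vertex_def)

lemma same_vertex_trans: "(i, j) \<in> same_vertex \<Longrightarrow> (j, k) \<in> same_vertex \<Longrightarrow> (i, k) \<in> same_vertex"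
  by (simp add: same_vertex_def)

lemma vertexE:
  assumes "V \<in> wicks_vertices w"
  obtains i where "i < n" "V = same_vertex `` {i}"
  using assms unfolding wicks_vertices_eq by (metis lessThan_iff quotientE)

lemma vertexI: "i < n \<Longrightarrow> same_vertex `` {i} \<in> wicks_vertices w"
  unfolding wicks_vertices_eq by (simp add: quotientI)

lemma vertex_subset: "V \<in> wicks_vertices w \<Longrightarrow> V \<subseteq> {..<n}"
  by (elim vertexE) (auto dest: same_vertex_less)

lemma orbit_subset_vertex:
  assumes "i < n"
  shows "{i, t i, t (t i)} \<subseteq> same_vertex `` {i}"
  using same_vertex_refl same_vertex_t[OF assms]
    same_vertex_trans[OF same_vertex_t[OF assms] same_vertex_t[OF t_less]] by simp

lemma card_orbit:
  assumes "i < n"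
  shows "card {i, t i, t (t i)} = 3"
  using t_neq[of i] t_t_neq[of i] t_neq[of "t i"] t_less[of i] assms by (simp add: eq_commute)

lemma card_vertices_partition: "(\<Sum>V\<in>wicks_vertices w. card V) = n"
proof -
  have "card (\<Union> (wicks_vertices w)) = (\<Sum>V\<in>wicks_vertices w. card V)"
  proof (rule card_Union_disjoint)
    have "wicks_vertices w \<subseteq> UNIV // same_vertex"
      unfolding wicks_vertices_eq quotient_def by auto
    then show "pairwise disjnt (wicks_vertices w)"
      using quotient_disj[OF equiv_same_vertex] by (auto simp: pairwise_def disjnt_def)
    show "finite V" if "V \<in> wicks_vertices w" for V
      using vertex_subset[OF that] by (rule finite_subset) simp
  qed
  moreover have "\<Union> (wicks_vertices w) = {..<n}"
    using vertex_subset vertexI same_vertex_refl by fast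
  ultimately show ?thesis by simp
qed

end

text \<open>Every vertex has at least three corners, and there are \<open>n\<close> corners in all;
  with a third of \<open>n\<close> as the number of vertices there is no room for a fourth
  corner.\<close>

lemma (in wicks_word) vertex_eq_orbit:
  assumes "3 * card (wicks_vertices w) = n" "i < n"
  shows "same_vertex `` {i} = {i, t i, t (t i)}"
proof -
  have fin: "finite (wicks_vertices w)" by (simp add: wicks_vertices_eq quotient_def)
  have ge: "3 \<le> card V" if "V \<in> wicks_vertices w" for V
  proof -
    obtain j where j: "j < n" "V = same_vertex `` {j}"
      using \<open>V \<in> wicks_vertices w\<close> by (rule vertexE)
    have "finite V" using vertex_subset[OF that] by (rule finite_subset) simp
    then show ?thesis using card_mono[OF _ orbit_subset_vertex[OF j(1)]] card_orbit[OF j(1)] j by simp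
  qed
  have eq: "card V = 3" if V: "V \<in> wicks_vertices w" for V
  proof (rule ccontr)
    assume "card V \<noteq> 3"
    then have "3 < card V" using ge[OF V] by simp
    then have "(\<Sum>V\<in>wicks_vertices w. 3) < (\<Sum>V\<in>wicks_vertices w. card V)"
      using fin V ge by (intro sum_strict_mono_ex1) auto
    then show False using assms(1) card_vertices_partition by simp
  qed
  have "same_vertex `` {i} \<in> wicks_vertices w"
    using assms(2) by (rule vertexI)
  then have "card (same_vertex `` {i}) = 3" by (rule eq)
  moreover from this have "finite (same_vertex `` {i})" by (metis card.infinite zero_neq_numeral)
  ultimately show ?thesis
    using orbit_subset_vertex[OF assms(2)] card_orbit[OF assms(2)] by (metis card_subset_eq)
qed

text \<open>Maximality in the form in which it is used: length \<open>6 * (2 * g - 1)\<close> and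
  genus \<open>g\<close> give \<open>4 * g - 2\<close> vertices by the Euler characteristic.\<close>

locale maximal_wicks_word = wicks_word +
  assumes card_vertices: "3 * card (wicks_vertices w) = length w"
begin

text \<open>\<open>t (t (t i))\<close> stays in a vertex of three corners and differs from two of
  them, \<open>t i\<close> and \<open>t (t i)\<close>.\<close>

lemma t_cubed: "t (t (t i)) = i mod n"
proof -
  define j where "j = i mod n"
  have j: "j < n" "t j = t i" using length_pos t_mod by (auto simp: j_def)
  have "t (t (t j)) \<in> same_vertex `` {j}"
    using orbit_subset_vertex[OF j(1)] same_vertex_trans[OF _ same_vertex_t[OF t_less], of j "t j"]
    by simp
  then have "t (t (t j)) \<in> {j, t j, t (t j)}"
    using vertex_eq_orbit[OF card_vertices j(1)] by simp
  moreover have "t (t (t j)) \<noteq> t (t j)" using t_neq[of "t (t j)"] t_less by simp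
  moreover have "t (t (t j)) \<noteq> t j" using t_t_neq[of "t j"] t_less by simp
  ultimately show ?thesis using j by (simp add: j_def)
qed

sublocale cubic_gluing "length w" "partner w"
  by unfold_locales (rule t_cubed)

end

lemma maximal_wicks_wordI:
  assumes "w \<in> maximal_wicks_forms g" "1 \<le> g"
  shows "maximal_wicks_word w" "length w = 6 * (2 * g - 1)"
proof -
  show len: "length w = 6 * (2 * g - 1)"
    using assms by (auto simp: maximal_wicks_forms_def)
  interpret wicks_word w
    using assms len by unfold_locales (auto simp: maximal_wicks_forms_def)
  have "int (card (wicks_vertices w)) = 1 - 2 * int g + int (card (wicks_edges w))"
    using assms by (simp add: maximal_wicks_forms_def has_genus_def wicks_euler_char_def)
  then have "3 * card (wicks_vertices w) = length w"
    using card_edges len assms(2) by linarith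
  then show "maximal_wicks_word w" by unfold_locales
qed

section \<open>Automorphisms and equivalence\<close>

text \<open>Rotation by \<open>k\<close> carries the gluing \<open>s\<close> to \<open>s'\<close>.
  Equivalence of forms compares two gluings in this way; automorphisms are the case
  \<open>s = s'\<close>.\<close>

definition shift_conj :: "nat \<Rightarrow> (nat \<Rightarrow> nat) \<Rightarrow> (nat \<Rightarrow> nat) \<Rightarrow> nat \<Rightarrow> bool" where
  "shift_conj n s s' k \<longleftrightarrow> (\<forall>i. s' (i + k) = (s i + k) mod n)"

lemma shift_conj_trans:
  assumes "shift_conj n s s' k" "shift_conj n s' s'' l"
  shows "shift_conj n s s'' (k + l)"
proof -
  have "s'' (i + (k + l)) = (s i + (k + l)) mod n" for i
  proof -
    have "s'' (i + (k + l)) = (s' (i + k) + l) mod n"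
      using assms(2) unfolding shift_conj_def add.assoc[symmetric] by blast
    also have "s' (i + k) = (s i + k) mod n" using assms(1) unfolding shift_conj_def by blast
    also have "((s i + k) mod n + l) mod n = (s i + k + l) mod n" by (rule mod_add_left_eq)
    finally show ?thesis by (simp only: add.assoc)
  qed
  then show ?thesis unfolding shift_conj_def by blast
qed

lemma shift_conj_0: "gluing n s \<Longrightarrow> shift_conj n s s 0"
  by (simp add: shift_conj_def gluing.s_less)

lemma shift_conj_mod:
  assumes "gluing n s'"
  shows "shift_conj n s s' (k mod n) \<longleftrightarrow> shift_conj n s s' k"
proof -
  interpret gluing n s' by fact
  have "s' (i + k mod n) = s' (i + k)" for i by (rule s_cong_mod) (rule mod_add_right_eq)
  then show ?thesis by (simp only: shift_conj_def mod_add_right_eq)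
qed

lemma shift_conj_sym:
  assumes "gluing n s" "gluing n s'" "shift_conj n s s' k"
  shows "shift_conj n s' s (n - k mod n)"
proof -
  interpret s: gluing n s by fact
  interpret s': gluing n s' by fact
  have "s (i + (n - k mod n)) = (s' i + (n - k mod n)) mod n" for i
  proof -
    have k: "(j + (n - k mod n) + k) mod n = j mod n" for j
    proof -
      have "(j + (n - k mod n) + k) mod n = (j + (n - k mod n) + k mod n) mod n" by (simp add: mod_simps)
      also have "j + (n - k mod n) + k mod n = j + n"
        using mod_less_divisor[OF s.n_pos, of k] by linarith
      finally show ?thesis by simp
    qed
    have "s' i = s' (i + (n - k mod n) + k)" using k by (metis s'.s_cong_mod)
    also have "\<dots> = (s (i + (n - k mod n)) + k) mod n" using assms(3) unfolding shift_conj_def by blast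
    finally have "(s' i + (n - k mod n)) mod n = (s (i + (n - k mod n)) + k + (n - k mod n)) mod n"
      by (simp add: mod_simps)
    also have "\<dots> = s (i + (n - k mod n)) mod n"
      using k[of "s (i + (n - k mod n))"] by (simp add: add_ac)
    finally show ?thesis using s.s_less by simp
  qed
  then show ?thesis by (simp add: shift_conj_def)
qed

lemma shift_conj_t:
  assumes "gluing n s" "gluing n s'" "shift_conj n s s' k"
  shows "gluing.t n s' (i + k) = (gluing.t n s i + k) mod n"
proof -
  interpret s: gluing n s by fact
  interpret s': gluing n s' by fact
  have "s' (i + k) = Suc (s.t i + k) mod n"
    using assms(3) mod_add_left_eq[of "Suc (s.t i)" n k] by (simp add: shift_conj_def s.Suc_t)
  then show ?thesis by (simp add: s'.t_eq_iff)
qed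

lemma mod_add_right_cancel: "((a::nat) + k) mod n = (b + k) mod n \<longleftrightarrow> a mod n = b mod n"
  by (metis (no_types, lifting) cong_add_rcancel_nat cong_def)

lemma card_shift_invariant:
  assumes "0 < n" "\<And>i. P (i mod n) \<longleftrightarrow> P i" "\<And>i. Q (i mod n) \<longleftrightarrow> Q i"
    and "\<And>i. Q (i + k) \<longleftrightarrow> P i"
  shows "card {i. i < n \<and> P i} = card {i. i < n \<and> Q (i::nat)}"
proof -
  have "inj_on (\<lambda>i. (i + k) mod n) {..<n}"
    by (auto simp: inj_on_def mod_add_right_cancel)
  then have "bij_betw (\<lambda>i. (i + k) mod n) {..<n} {..<n}"
    using assms(1) by (intro bij_betw_imageI endo_inj_surj) auto
  then have "bij_betw (\<lambda>i. (i + k) mod n) {i \<in> {..<n}. P i} {i \<in> {..<n}. Q i}"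
    by (rule bij_betw_Collect) (simp add: assms(3,4))
  then show ?thesis using bij_betw_same_card by fastforce
qed

text \<open>Reversed edges and fixed vertices are later expressed through these two counts. They
  refer to the gluing alone, so rotating and relabelling leave them unchanged.\<close>

definition turned_sides :: "letter list \<Rightarrow> nat \<Rightarrow> nat" where
  "turned_sides w k = card {i. i < length w \<and> partner w i = (i + k) mod length w}"

definition turned_corners :: "letter list \<Rightarrow> nat \<Rightarrow> nat" where
  "turned_corners w k = card {i. i < length w \<and> corner_succ w i = (i + k) mod length w}"

text \<open>The letters matter only through the gluing: a bijection compatible with inverses exists
  exactly if the rotation respects partners.\<close>

lemma relabelling_iff:
  assumes "wicks_word w" "wicks_word w'"
  shows "(\<exists>\<phi>. relabelling \<phi> w (rotate k w')) \<longleftrightarrow>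
    length w' = length w \<and> shift_conj (length w) (partner w) (partner w') k"
proof
  interpret w: wicks_word w by fact
  interpret w': wicks_word w' by fact
  assume "\<exists>\<phi>. relabelling \<phi> w (rotate k w')"
  then obtain \<phi> where \<phi>: "relabelling \<phi> w (rotate k w')" by blast
  then have eq: "rotate k w' = map \<phi> w" by (simp add: relabelling_def)
  then have len: "length w' = length w" by (metis length_map length_rotate)
  have at: "w'.letter_at (i + k) = \<phi> (w.letter_at i)" for i
  proof -
    have "rotate k w' ! (i mod w.n) = \<phi> (w.letter_at i)" using w.length_pos by (simp add: eq)
    then show ?thesis using w.length_pos len by (simp add: nth_rotate mod_simps add.commute)
  qed
  have "partner w' (i + k) = (partner w i + k) mod w.n" for i
  proof -
    have "w'.letter_at (partner w i + k) = \<phi> (linv (w.letter_at i))"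
      by (simp add: at w.letter_at_partner)
    also have "\<dots> = linv (w'.letter_at (i + k))"
      using \<phi> w.letter_at_in_set by (simp add: at relabelling_def)
    finally show ?thesis using w'.partner_eq_iff[of "i + k" "partner w i + k"] len by simp
  qed
  then show "length w' = length w \<and> shift_conj (length w) (partner w) (partner w') k"
    using len by (simp add: shift_conj_def)
next
  interpret w: wicks_word w by fact
  interpret w': wicks_word w' by fact
  assume "length w' = length w \<and> shift_conj (length w) (partner w) (partner w') k"
  then have len: "length w' = length w"
    and conj: "\<And>i. partner w' (i + k) = (partner w i + k) mod w.n"
    by (auto simp: shift_conj_def)
  \<comment> \<open>The letter at position \<open>i\<close> of \<open>w\<close> has to go to the
    letter at position \<open>i + k\<close> of \<open>w'\<close>; the position is unique because
    \<open>w\<close> is distinct.\<close>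
  define \<phi> where "\<phi> x = w'.letter_at ((THE i. i < w.n \<and> w ! i = x) + k)" for x
  have \<phi>: "\<phi> (w ! i) = w'.letter_at (i + k)" if "i < w.n" for i
  proof -
    have "(THE j. j < w.n \<and> w ! j = w ! i) = i"
      using that w.distinct_word by (auto simp: nth_eq_iff_index_eq)
    then show ?thesis by (simp add: \<phi>_def)
  qed
  have eq: "rotate k w' = map \<phi> w"
    by (rule nth_equalityI) (auto simp: len nth_rotate \<phi> add.commute)
  have "\<phi> (linv x) = linv (\<phi> x)" if "x \<in> set w" for x
  proof -
    have "\<exists>i<w.n. w ! i = x" using that by (simp only: in_set_conv_nth)
    then obtain i where i: "i < w.n" "w ! i = x" by (elim exE conjE)
    have "w ! partner w i = linv (w.letter_at i)" using w.partner_props by (rule conjunct2)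
    then have "linv x = w ! partner w i" by (simp only: i mod_less)
    then have "\<phi> (linv x) = w'.letter_at (partner w i + k)" by (simp add: \<phi> w.partner_less)
    also have "\<dots> = w' ! partner w' (i + k)" by (simp add: conj len)
    also have "\<dots> = linv (\<phi> x)" using w'.partner_props[of "i + k"] \<phi>[OF i(1)] i(2) by simp
    finally show ?thesis .
  qed
  moreover have "bij_betw \<phi> (set w) (set (rotate k w'))"
  proof -
    \<comment> \<open>Injectivity by counting: both words are distinct and of the same
      length.\<close>
    have "card (\<phi> ` set w) = card (set w)"
      using eq len w.distinct_word w'.distinct_word
      by (metis distinct_card length_map set_map distinct_rotate length_rotate)
    then have "inj_on \<phi> (set w)" by (simp add: eq_card_imp_inj_on)
    then show ?thesis unfolding bij_betw_def eq by simp
  qed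
  ultimately show "\<exists>\<phi>. relabelling \<phi> w (rotate k w')"
    unfolding relabelling_def using eq by blast
qed

lemma wicks_equivD:
  assumes "wicks_word w" "(w, w') \<in> wicks_equiv"
  shows "wicks_word w'" "length w' = length w"
    "\<exists>k. shift_conj (length w) (partner w) (partner w') k"
proof -
  obtain k \<phi> where k: "oriented_wicks_form w'" "relabelling \<phi> w (rotate k w')"
    using assms(2) by (auto simp: wicks_equiv_def)
  then have len: "length w' = length w" by (metis relabelling_def length_map length_rotate)
  then show w': "wicks_word w'" using k(1) assms(1) by (auto simp: wicks_word_def)
  show "length w' = length w" "\<exists>k. shift_conj (length w) (partner w) (partner w') k"
    using relabelling_iff[OF assms(1) w', of k] k(2) by auto
qed

lemma wicks_equivI:
  assumes "wicks_word w" "wicks_word w'" "length w' = length w"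
    and "shift_conj (length w) (partner w) (partner w') k"
  shows "(w, w') \<in> wicks_equiv"
  using relabelling_iff[OF assms(1,2), of k] assms
  by (auto simp: wicks_equiv_def wicks_word_def)

lemma wicks_word_gluing: "wicks_word w \<Longrightarrow> gluing (length w) (partner w)"
proof -
  assume "wicks_word w"
  then interpret wicks_word w .
  show ?thesis by (rule gluing_axioms)
qed

lemma wicks_equiv_refl: "wicks_word w \<Longrightarrow> (w, w) \<in> wicks_equiv"
  by (rule wicks_equivI[where k = 0]) (auto intro: shift_conj_0 wicks_word_gluing)

lemma wicks_equiv_sym:
  assumes "wicks_word w" "(w, w') \<in> wicks_equiv"
  shows "(w', w) \<in> wicks_equiv"
proof -
  note D = wicks_equivD[OF assms]
  obtain k where "shift_conj (length w) (partner w) (partner w') k" using D(3) by blast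
  then have "shift_conj (length w) (partner w') (partner w) (length w - k mod length w)"
    using wicks_word_gluing[OF assms(1)] wicks_word_gluing[OF D(1)] D(2) by (metis shift_conj_sym)
  then show ?thesis using wicks_equivI[OF D(1) assms(1)] D(2) by metis
qed

lemma wicks_equiv_trans:
  assumes "wicks_word w" "(w, w') \<in> wicks_equiv" "(w', w'') \<in> wicks_equiv"
  shows "(w, w'') \<in> wicks_equiv"
proof -
  note D = wicks_equivD[OF assms(1,2)]
  note D' = wicks_equivD[OF D(1) assms(3)]
  show ?thesis
    using wicks_equivI[OF assms(1) D'(1)] D D' by (metis shift_conj_trans)
qed

lemma turned_sides_invariant:
  assumes "wicks_word w" "(w, w') \<in> wicks_equiv"
  shows "turned_sides w' j = turned_sides w j"
proof -
  note D = wicks_equivD[OF assms]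
  obtain k where k: "shift_conj (length w) (partner w) (partner w') k" using D(3) by blast
  interpret w: wicks_word w by fact
  interpret w': wicks_word w' by fact
  show ?thesis unfolding turned_sides_def D(2)
  proof (rule card_shift_invariant[symmetric, where k = k])
    fix i
    have "partner w' (i + k) = (partner w i + k) mod w.n" using k by (simp add: shift_conj_def)
    then show "partner w' (i + k) = (i + k + j) mod w.n \<longleftrightarrow> partner w i = (i + j) mod w.n"
      using mod_add_right_cancel[of "partner w i" k w.n "i + j"] w.partner_less[of i]
      by (simp add: add_ac)
  qed (use w.length_pos w.s_mod w'.s_mod D(2) in \<open>auto simp: mod_simps\<close>)
qed

lemma turned_corners_invariant:
  assumes "wicks_word w" "(w, w') \<in> wicks_equiv"
  shows "turned_corners w' j = turned_corners w j"
proof -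
  note D = wicks_equivD[OF assms]
  obtain k where k: "shift_conj (length w) (partner w) (partner w') k" using D(3) by blast
  interpret w: wicks_word w by fact
  interpret w': wicks_word w' by fact
  have g: "gluing w.n (partner w')" using w'.gluing_axioms D(2) by simp
  show ?thesis unfolding turned_corners_def D(2)
  proof (rule card_shift_invariant[symmetric, where k = k])
    fix i
    have "gluing.t w.n (partner w') (i + k) = (w.t i + k) mod w.n"
      by (rule shift_conj_t[OF w.gluing_axioms g k])
    then show "gluing.t w.n (partner w') (i + k) = (i + k + j) mod w.n \<longleftrightarrow> w.t i = (i + j) mod w.n"
      using mod_add_right_cancel[of "w.t i" k w.n "i + j"] w.t_less[of i]
      by (simp add: add_ac)
  qed (use w.length_pos w.t_mod gluing.t_mod[OF g] in \<open>auto simp: mod_simps\<close>)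
qed

section \<open>The automorphism group as a cyclic group of rotations\<close>

context wicks_word
begin

abbreviation automorphic_shift :: "nat \<Rightarrow> bool" where
  "automorphic_shift \<equiv> shift_conj n (partner w) (partner w)"

lemma carrier_Aut: "carrier (wicks_Aut w) = {k. k < n \<and> automorphic_shift k}"
  using relabelling_iff[OF wicks_word_axioms wicks_word_axioms] by (simp add: wicks_Aut_def)

lemma group_Aut: "group (wicks_Aut w)"
proof (rule groupI)
  fix j k l assume j: "j \<in> carrier (wicks_Aut w)" and k: "k \<in> carrier (wicks_Aut w)"
    and l: "l \<in> carrier (wicks_Aut w)"
  show "j \<otimes>\<^bsub>wicks_Aut w\<^esub> k \<in> carrier (wicks_Aut w)"
    using j k shift_conj_trans[of n "partner w" "partner w" j "partner w" k] length_pos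
    by (simp add: carrier_Aut shift_conj_mod[OF gluing_axioms]) (simp add: wicks_Aut_def shift_conj_mod[OF gluing_axioms])
  show "j \<otimes>\<^bsub>wicks_Aut w\<^esub> k \<otimes>\<^bsub>wicks_Aut w\<^esub> l = j \<otimes>\<^bsub>wicks_Aut w\<^esub> (k \<otimes>\<^bsub>wicks_Aut w\<^esub> l)"
    by (simp add: wicks_Aut_def mod_simps add.assoc)
next
  show "\<one>\<^bsub>wicks_Aut w\<^esub> \<in> carrier (wicks_Aut w)"
    using length_pos shift_conj_0[OF gluing_axioms] by (simp add: carrier_Aut) (simp add: wicks_Aut_def)
next
  fix k assume k: "k \<in> carrier (wicks_Aut w)"
  show "\<one>\<^bsub>wicks_Aut w\<^esub> \<otimes>\<^bsub>wicks_Aut w\<^esub> k = k"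
    using k by (simp add: carrier_Aut) (simp add: wicks_Aut_def)
  have "(n - k mod n) mod n \<in> carrier (wicks_Aut w)"
    using k shift_conj_sym[OF gluing_axioms gluing_axioms] length_pos
    by (simp add: carrier_Aut shift_conj_mod[OF gluing_axioms] del: mod_less)
  moreover have "((n - k mod n) mod n + k) mod n = 0"
    using k by (simp add: carrier_Aut mod_simps)
  ultimately show "\<exists>j\<in>carrier (wicks_Aut w). j \<otimes>\<^bsub>wicks_Aut w\<^esub> k = \<one>\<^bsub>wicks_Aut w\<^esub>"
    by (intro bexI) (simp_all add: wicks_Aut_def)
qed

lemma pow_Aut: "k [^]\<^bsub>wicks_Aut w\<^esub> (m::nat) = (m * k) mod n"
proof (induction m)
  case (Suc m)
  then show ?case by (simp add: nat_pow_def) (simp add: wicks_Aut_def mod_simps add.commute)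
qed (simp add: nat_pow_def wicks_Aut_def)

lemma finite_Aut: "finite (carrier (wicks_Aut w))"
  by (simp add: carrier_Aut)

lemma order_Aut_pos: "0 < order (wicks_Aut w)"
  unfolding order_def card_gt_0_iff
  using finite_Aut monoid.one_closed[OF group.is_monoid[OF group_Aut]] by blast

lemma ord_Aut_dvd_iff:
  assumes "k \<in> carrier (wicks_Aut w)"
  shows "group.ord (wicks_Aut w) k dvd m \<longleftrightarrow> n dvd m * k"
  using group.pow_eq_id[OF group_Aut assms, of m] unfolding pow_Aut
  by (simp add: wicks_Aut_def mod_eq_0_iff_dvd)

lemma automorphic_shift_mult: "automorphic_shift k \<Longrightarrow> automorphic_shift (m * k)"
  by (induction m) (auto simp: shift_conj_0[OF gluing_axioms] intro: shift_conj_trans)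

text \<open>A group of residues modulo \<open>n\<close> is generated by \<open>n\<close> divided by
  its order. By Lagrange \<open>n\<close> divides \<open>?K * k\<close> for every element
  \<open>k\<close>, hence \<open>N = n div e\<close> divides \<open>k\<close>. Only \<open>e\<close>
  multiples of \<open>N\<close> lie below \<open>n\<close>, and \<open>e = gcd n ?K\<close> is at
  most \<open>?K\<close>, so all of them are elements.\<close>

lemma order_Aut_structure:
  shows "order (wicks_Aut w) dvd n" "automorphic_shift (n div order (wicks_Aut w))"
proof -
  let ?K = "order (wicks_Aut w)"
  define e where "e = gcd n ?K"
  define N where "N = n div e"
  have e: "e dvd n" "e dvd ?K" "0 < e" using length_pos by (auto simp: e_def)
  have nN: "n = e * N" using e by (simp add: N_def)
  have N: "0 < N" using nN length_pos by (auto intro: gr0I)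
  have sub: "carrier (wicks_Aut w) \<subseteq> (\<lambda>j. j * N) ` {..<e}"
  proof
    fix k assume k: "k \<in> carrier (wicks_Aut w)"
    have "n dvd ?K * k"
      using ord_Aut_dvd_iff[OF k, of ?K] group.ord_dvd_group_order[OF group_Aut k] by simp
    then have "e * N dvd e * (?K div e * k)" using e nN by (simp add: mult.assoc[symmetric])
    then have "N dvd ?K div e * k" using e by simp
    moreover have "coprime N (?K div e)"
      unfolding N_def e_def by (rule div_gcd_coprime) (use length_pos in simp)
    ultimately have "N dvd k" by (metis coprime_dvd_mult_right_iff)
    then obtain j where "k = j * N" by (metis dvd_div_mult_self)
    moreover have "j < e" using k nN calculation by (simp add: carrier_Aut)
    ultimately show "k \<in> (\<lambda>j. j * N) ` {..<e}" by blast
  qed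
  have inj: "inj_on (\<lambda>j. j * N) {..<e}" using N by (auto simp: inj_on_def)
  then have card: "card ((\<lambda>j. j * N) ` {..<e}) = e" by (simp add: card_image)
  then have "?K \<le> e" unfolding order_def using card_mono[OF _ sub] by simp
  moreover have "e \<le> ?K" using e(2) order_Aut_pos by (rule dvd_imp_le)
  ultimately have Ke: "?K = e" by simp
  then show "?K dvd n" using e by simp
  have eq: "carrier (wicks_Aut w) = (\<lambda>j. j * N) ` {..<e}"
    by (rule card_subset_eq[OF _ sub]) (use Ke card in \<open>simp_all add: order_def\<close>)
  \<comment> \<open>For the trivial group the generator is the full turn \<open>n\<close>, which
    lies outside the carrier and is treated as a shift by 0.\<close>
  show "automorphic_shift (n div ?K)"
  proof (cases "e = 1")
    case True
    then have "n div ?K = n" using Ke by simp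
    then show ?thesis
      using shift_conj_mod[OF gluing_axioms, of "partner w" n] shift_conj_0[OF gluing_axioms] by simp
  next
    case False
    then have "1 * N \<in> carrier (wicks_Aut w)" unfolding eq using e(3) by (intro imageI) auto
    then show ?thesis using Ke by (simp add: carrier_Aut N_def)
  qed
qed

lemma dvd_order_Aut:
  assumes "d dvd order (wicks_Aut w)"
  shows "d dvd n" "automorphic_shift (n div d)"
proof -
  let ?K = "order (wicks_Aut w)"
  show "d dvd n" using assms order_Aut_structure(1) by (rule dvd_trans)
  obtain a b where "?K = d * a" "n = ?K * b" using assms order_Aut_structure(1) by (metis dvdE)
  then have "n div d = a * (n div ?K)" using order_Aut_pos by (cases "d = 0") simp_all
  then show "automorphic_shift (n div d)"
    using automorphic_shift_mult[OF order_Aut_structure(2)] by simp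
qed

lemma div_in_carrier_Aut:
  assumes "d dvd order (wicks_Aut w)" "1 < d"
  shows "n div d \<in> carrier (wicks_Aut w)" "group.ord (wicks_Aut w) (n div d) = d"
proof -
  note D = dvd_order_Aut[OF assms(1)]
  obtain N where N: "n = d * N" using D(1) by blast
  then have N0: "0 < N" "n div d = N" using length_pos assms(2) by (auto intro: gr0I)
  show c: "n div d \<in> carrier (wicks_Aut w)"
    using D length_pos assms(2) by (simp add: carrier_Aut)
  have "group.ord (wicks_Aut w) (n div d) dvd m \<longleftrightarrow> d dvd m" for m
    unfolding ord_Aut_dvd_iff[OF c] using N N0 by simp
  then show "group.ord (wicks_Aut w) (n div d) = d" by (meson dvd_antisym dvd_refl)
qed

lemma ord_Aut_dvd_order:
  "k \<in> carrier (wicks_Aut w) \<Longrightarrow> group.ord (wicks_Aut w) k dvd order (wicks_Aut w)"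
  by (rule group.ord_dvd_group_order[OF group_Aut])

end

text \<open>Rotations commute, so conjugation by the rotation that relates the two words is trivial
  and the carriers coincide as sets.\<close>

lemma order_Aut_invariant:
  assumes "wicks_word w" "(w, w') \<in> wicks_equiv"
  shows "order (wicks_Aut w') = order (wicks_Aut w)"
proof -
  note D = wicks_equivD[OF assms]
  obtain k where k: "shift_conj (length w) (partner w) (partner w') k" using D(3) by blast
  interpret w: wicks_word w by fact
  interpret w': wicks_word w' by fact
  have g: "gluing w.n (partner w')" using w'.gluing_axioms D(2) by simp
  note k' = shift_conj_sym[OF w.gluing_axioms g k]
  have cyc: "shift_conj w.n s s (a + j + b) \<longleftrightarrow> shift_conj w.n s s j"
    if "gluing w.n s" "(a + b) mod w.n = 0" for s a b j
  proof -
    have "(a + j + b) mod w.n = (j + (a + b)) mod w.n" by (simp add: add_ac)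
    also have "\<dots> = (j + (a + b) mod w.n) mod w.n" by (simp add: mod_simps)
    finally have "(a + j + b) mod w.n = j mod w.n" using that by simp
    then show ?thesis using shift_conj_mod[OF that(1)] by metis
  qed
  have "(k + (w.n - k mod w.n)) mod w.n = (k mod w.n + (w.n - k mod w.n)) mod w.n"
    by (simp only: mod_add_left_eq)
  also have "\<dots> = 0" using w.length_pos by simp
  finally have z: "(k + (w.n - k mod w.n)) mod w.n = 0" .
  then have z': "(w.n - k mod w.n + k) mod w.n = 0" by (simp only: add.commute)
  have "w.automorphic_shift j \<longleftrightarrow> shift_conj w.n (partner w') (partner w') j" for j
  proof
    assume "w.automorphic_shift j"
    then have "shift_conj w.n (partner w') (partner w') ((w.n - k mod w.n) + j + k)"
      using k k' by (meson shift_conj_trans)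
    then show "shift_conj w.n (partner w') (partner w') j" using cyc[OF g z'] by blast
  next
    assume "shift_conj w.n (partner w') (partner w') j"
    then have "w.automorphic_shift (k + j + (w.n - k mod w.n))"
      using k k' by (meson shift_conj_trans)
    then show "w.automorphic_shift j" using cyc[OF w.gluing_axioms z] by blast
  qed
  then have "carrier (wicks_Aut w') = carrier (wicks_Aut w)"
    using D(2) by (auto simp: w.carrier_Aut w'.carrier_Aut)
  then show ?thesis by (simp add: order_def)
qed

section \<open>Reversed edges and fixed vertices\<close>

context maximal_wicks_word
begin

lemma shiftedI:
  assumes "d dvd order (wicks_Aut w)"
  shows "shifted_cubic_gluing n (partner w) (n div d)"
proof -
  note D = dvd_order_Aut[OF assms]
  show ?thesis
  proof
    show "n div d dvd n" using D(1) by (metis dvd_div_mult_self dvd_triv_left)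
    show "partner w (i + n div d) = (partner w i + n div d) mod n" for i
      using D(2) unfolding shift_conj_def by blast
  qed
qed

lemma turned_sides_quotient:
  assumes "d dvd order (wicks_Aut w)"
  shows "turned_sides w j = d * card {i. i < n div d \<and> partner w i = (i + j) mod n}"
proof -
  interpret sh: shifted_cubic_gluing n "partner w" "n div d" by (rule shiftedI[OF assms])
  have "card {i. i < d * (n div d) \<and> partner w i = (i + j) mod n}
    = d * card {i. i < n div d \<and> partner w i = (i + j) mod n}"
  proof (rule card_periodic)
    fix i
    show "partner w (i + n div d) = (i + n div d + j) mod n \<longleftrightarrow> partner w i = (i + j) mod n"
      using sh.s_shift[of i] mod_add_right_cancel[of "partner w i" "n div d" n "i + j"]
        partner_less[of i] by (simp add: add_ac)
  qed
  then show ?thesis using dvd_order_Aut(1)[OF assms] by (simp add: turned_sides_def)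
qed

lemma turned_corners_quotient:
  assumes "d dvd order (wicks_Aut w)"
  shows "turned_corners w j = d * card {i. i < n div d \<and> t i = (i + j) mod n}"
proof -
  interpret sh: shifted_cubic_gluing n "partner w" "n div d" by (rule shiftedI[OF assms])
  have "card {i. i < d * (n div d) \<and> t i = (i + j) mod n}
    = d * card {i. i < n div d \<and> t i = (i + j) mod n}"
  proof (rule card_periodic)
    fix i
    show "t (i + n div d) = (i + n div d + j) mod n \<longleftrightarrow> t i = (i + j) mod n"
      using sh.t_shift[of i] mod_add_right_cancel[of "t i" "n div d" n "i + j"]
        t_less[of i] by (simp add: add_ac)
  qed
  then show ?thesis using dvd_order_Aut(1)[OF assms] by (simp add: turned_corners_def)
qed

lemma order_Aut_dvd_6: "order (wicks_Aut w) dvd 6"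
proof -
  interpret shifted_cubic_gluing n "partner w" "n div order (wicks_Aut w)"
    by (rule shiftedI) simp
  have "order (wicks_Aut w) * (n div order (wicks_Aut w)) dvd 6 * (n div order (wicks_Aut w))"
    using shift_order_dvd_6 order_Aut_structure(1) by simp
  then show ?thesis using N_pos by simp
qed

text \<open>The only element of order 2 is the half turn. The two sides of a reversed edge lie half
  a turn apart, so exactly one is in the first half of the polygon; these sides form
  \<open>I\<close>.\<close>

lemma card_reversed_edges:
  assumes ord: "2 dvd order (wicks_Aut w)"
    and k: "k \<in> carrier (wicks_Aut w)" "group.ord (wicks_Aut w) k = 2"
    and \<phi>: "relabelling \<phi> w (rotate k w)"
  shows "2 * card (reversed_edges w \<phi>) = turned_sides w (n div 2)"
proof -
  define N where "N = n div 2"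
  interpret sh: shifted_cubic_gluing n "partner w" N unfolding N_def by (rule shiftedI[OF ord])
  have n: "n = 2 * N" using dvd_order_Aut(1)[OF ord] by (simp add: N_def)
  have "n dvd 2 * k" using ord_Aut_dvd_iff[OF k(1), of 2] k(2) by simp
  then have "N dvd k" using n by simp
  moreover have "k \<noteq> 0" using ord_Aut_dvd_iff[OF k(1), of 1] k(2) by (intro notI) simp
  moreover have "k < 2 * N" using k(1) n by (simp add: carrier_Aut)
  ultimately have kN: "k = N" by (auto elim!: dvdE)
  define I where "I = {i. i < N \<and> partner w i = (i + N) mod n}"
  let ?e = "\<lambda>i. {w ! i, linv (w ! i)}"
  have at: "\<phi> (letter_at i) = letter_at (i + N)" for i
  proof -
    have "map \<phi> w ! (i mod n) = rotate N w ! (i mod n)" using \<phi> kN by (simp add: relabelling_def)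
    then show ?thesis using length_pos by (simp add: nth_rotate mod_simps add.commute)
  qed
  have rev: "\<phi> (letter_at i) = linv (letter_at i) \<longleftrightarrow> partner w i = (i + N) mod n" for i
    using at partner_eq_iff by simp
  have "reversed_edges w \<phi> = ?e ` I"
  proof (intro subset_antisym subsetI)
    fix e assume "e \<in> reversed_edges w \<phi>"
    then obtain x where e: "e = {x, linv x}" "x \<in> set w" "\<phi> x = linv x"
    proof -
      obtain y x where y: "y \<in> set w" "e = {y, linv y}" "x \<in> e" "\<phi> x = linv x"
        using \<open>e \<in> reversed_edges w \<phi>\<close> by (auto simp: reversed_edges_def wicks_edges_def)
      then have "x = y \<or> x = linv y" by simp
      then have "e = {x, linv x}" "x \<in> set w" using y linv_in_set[OF y(1)] by auto
      then show ?thesis using y that by blast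
    qed
    obtain j where j: "j < n" "x = w ! j" using e(2) by (auto simp: in_set_conv_nth)
    have pj: "partner w j = (j + N) mod n" using rev[of j] e j by simp
    have lx: "linv x = w ! partner w j" using partner_props[of j] j by simp
    show "e \<in> ?e ` I"
    proof (cases "j < N")
      case True
      then show ?thesis using pj e j by (auto simp: I_def)
    next
      case False
      \<comment> \<open>Here the side in the first half is the partner of side
        \<open>j\<close>.\<close>
      define i where "i = j - N"
      have i: "i < N" "j = i + N" using False j n by (auto simp: i_def)
      have "j + N = i + n" using i n by simp
      then have "partner w j = (i + n) mod n" using pj by (simp only:)
      moreover have "i < n" using i j by simp
      ultimately have pi: "partner w j = i" by simp
      have "partner w i = j" using s_s[of j] pi j by simp
      then have "i \<in> I" using i n by (simp add: I_def)
      moreover have "e = ?e i" using lx pi e(1) by (metis insert_commute linv_linv)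
      ultimately show ?thesis by blast
    qed
  next
    fix e assume "e \<in> ?e ` I"
    then obtain i where i: "e = ?e i" "i \<in> I" by blast
    have iN: "i < n" using i(2) n by (simp add: I_def)
    then have "\<phi> (w ! i) = linv (w ! i)" using rev[of i] i(2) by (simp add: I_def)
    then show "e \<in> reversed_edges w \<phi>"
      using iN i(1) by (auto simp: reversed_edges_def wicks_edges_def simp del: linv.simps)
  qed
  moreover have "inj_on ?e I"
  proof (rule inj_onI)
    fix i j assume ij: "i \<in> I" "j \<in> I" "?e i = ?e j"
    then have lt: "i < N" "j < N" "i < n" "j < n" using n by (auto simp: I_def)
    have "w ! i = w ! j \<or> w ! i = linv (w ! j)" using ij(3) by (auto simp: doubleton_eq_iff)
    then show "i = j"
    proof
      assume "w ! i = w ! j"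
      then show ?thesis using letter_at_eq_iff[of i j] lt by simp
    next
      assume "w ! i = linv (w ! j)"
      then have "partner w j = i" using partner_eq_iff[of j i] lt by simp
      moreover have "partner w j = j + N" using ij(2) n lt by (simp add: I_def)
      ultimately show ?thesis using lt by simp
    qed
  qed
  ultimately have "card (reversed_edges w \<phi>) = card I" by (simp add: card_image)
  then show ?thesis
    using turned_sides_quotient[OF ord, of N] by (simp only: I_def N_def)
qed

end

section \<open>Signs of the vertices fixed by a rotation of order 3\<close>

text \<open>The second pattern in the definition is the first one with \<open>b\<close> and
  \<open>c\<close> exchanged; likewise for \<open>negative_vertex\<close>.\<close>

lemma positive_vertex_iff:
  "positive_vertex w V \<longleftrightarrow> (\<exists>a b c. letters_toward w V = {a, b, c} \<and>
    cyclic_pattern w [a, linv b] [b, linv c] [c, linv a])"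
proof
  assume "positive_vertex w V"
  then obtain a b c where L: "letters_toward w V = {a, b, c}"
    and P: "cyclic_pattern w [a, linv b] [b, linv c] [c, linv a] \<or> cyclic_pattern w [a, linv c] [c, linv b] [b, linv a]"
    unfolding positive_vertex_def by (elim exE conjE)
  have "{a, b, c} = {a, c, b}" by (simp only: insert_commute)
  then show "\<exists>a b c. letters_toward w V = {a, b, c} \<and> cyclic_pattern w [a, linv b] [b, linv c] [c, linv a]"
    using L P by metis
next
  assume "\<exists>a b c. letters_toward w V = {a, b, c} \<and> cyclic_pattern w [a, linv b] [b, linv c] [c, linv a]"
  then show "positive_vertex w V" unfolding positive_vertex_def by metis
qed

lemma negative_vertex_iff:
  "negative_vertex w V \<longleftrightarrow> (\<exists>a b c. letters_toward w V = {a, b, c} \<and>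
    cyclic_pattern w [a, linv b] [c, linv a] [b, linv c])"
proof
  assume "negative_vertex w V"
  then obtain a b c where L: "letters_toward w V = {a, b, c}"
    and P: "cyclic_pattern w [a, linv b] [c, linv a] [b, linv c] \<or> cyclic_pattern w [a, linv c] [b, linv a] [c, linv b]"
    unfolding negative_vertex_def by (elim exE conjE)
  have "{a, b, c} = {a, c, b}" by (simp only: insert_commute)
  then show "\<exists>a b c. letters_toward w V = {a, b, c} \<and> cyclic_pattern w [a, linv b] [c, linv a] [b, linv c]"
    using L P by metis
next
  assume "\<exists>a b c. letters_toward w V = {a, b, c} \<and> cyclic_pattern w [a, linv b] [c, linv a] [b, linv c]"
  then show "negative_vertex w V" unfolding negative_vertex_def by metis
qed

text \<open>\<open>p\<close> and \<open>q\<close> are the distances from the first factor to the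
  other two. Gaps of at least 2 keep the factors disjoint, and \<open>q + 2 \<le> n\<close> keeps
  the third from running into the first.\<close>

lemma (in wicks_word) cyclic_pattern_iff:
  "cyclic_pattern w [a, a'] [b, b'] [c, c'] \<longleftrightarrow>
    (\<exists>k p q. 2 \<le> p \<and> p + 2 \<le> q \<and> q + 2 \<le> n \<and> letter_at k = a \<and> letter_at (Suc k) = a' \<and>
      letter_at (k + p) = b \<and> letter_at (Suc (k + p)) = b' \<and>
      letter_at (k + q) = c \<and> letter_at (Suc (k + q)) = c')"
proof
  assume "cyclic_pattern w [a, a'] [b, b'] [c, c']"
  then obtain k u v x where z: "rotate k w = [a, a'] @ u @ [b, b'] @ v @ [c, c'] @ x"
    unfolding cyclic_pattern_def by blast
  let ?p = "length u + 2" and ?q = "length u + length v + 4"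
  have len: "n = length u + length v + length x + 6"
    using arg_cong[OF z, of length] by simp
  have at: "letter_at (k + j) = ([a, a'] @ u @ [b, b'] @ v @ [c, c'] @ x) ! j" if "j < n" for j
    using nth_rotate[OF that, of k] z by simp
  have "letter_at k = a" "letter_at (Suc k) = a'" "letter_at (k + ?p) = b" "letter_at (Suc (k + ?p)) = b'"
    "letter_at (k + ?q) = c" "letter_at (Suc (k + ?q)) = c'"
    using at[of 0] at[of 1] at[of ?p] at[of "Suc ?p"] at[of ?q] at[of "Suc ?q"] len
    by (simp_all add: nth_append ac_simps)
  then show "\<exists>k p q. 2 \<le> p \<and> p + 2 \<le> q \<and> q + 2 \<le> n \<and> letter_at k = a \<and> letter_at (Suc k) = a' \<and>
      letter_at (k + p) = b \<and> letter_at (Suc (k + p)) = b' \<and>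
      letter_at (k + q) = c \<and> letter_at (Suc (k + q)) = c'"
    using len by (intro exI[of _ k] exI[of _ ?p] exI[of _ ?q]) simp
next
  assume "\<exists>k p q. 2 \<le> p \<and> p + 2 \<le> q \<and> q + 2 \<le> n \<and> letter_at k = a \<and> letter_at (Suc k) = a' \<and>
      letter_at (k + p) = b \<and> letter_at (Suc (k + p)) = b' \<and>
      letter_at (k + q) = c \<and> letter_at (Suc (k + q)) = c'"
  then obtain k p q where pq: "2 \<le> p" "p + 2 \<le> q" "q + 2 \<le> n"
    and at: "letter_at k = a" "letter_at (Suc k) = a'"
      "letter_at (k + p) = b" "letter_at (Suc (k + p)) = b'"
      "letter_at (k + q) = c" "letter_at (Suc (k + q)) = c'" by blast
  define z where "z = rotate k w"
  have len: "length z = n" by (simp add: z_def)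
  have zat: "z ! j = letter_at (k + j)" if "j < n" for j
    using nth_rotate[OF that, of k] by (simp add: z_def)
  have two: "drop j z = [z ! j, z ! Suc j] @ drop (j + 2) z" if "j + 2 \<le> n" for j
    using that len by (simp add: Cons_nth_drop_Suc)
  have gap: "drop i z = take (j - i) (drop i z) @ drop j z" if "i \<le> j" for i j
    using append_take_drop_id[of "j - i" "drop i z"] that by simp
  have "z = [a, a'] @ drop 2 z"
    using two[of 0] zat[of 0] zat[of 1] at pq nonempty by (simp add: numeral_2_eq_2)
  moreover have "drop 2 z = take (p - 2) (drop 2 z) @ drop p z"
    using gap pq(1) by blast
  moreover have "drop p z = [b, b'] @ drop (p + 2) z"
    using two[of p] zat[of p] zat[of "Suc p"] at pq by simp
  moreover have "drop (p + 2) z = take (q - (p + 2)) (drop (p + 2) z) @ drop q z"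
    using gap pq(2) by blast
  moreover have "drop q z = [c, c'] @ drop (q + 2) z"
    using two[of q] zat[of q] zat[of "Suc q"] at pq by simp
  ultimately have "z = [a, a'] @ take (p - 2) (drop 2 z) @ [b, b'] @
    take (q - (p + 2)) (drop (p + 2) z) @ [c, c'] @ drop (q + 2) z" by metis
  then show "cyclic_pattern w [a, a'] [b, b'] [c, c']"
    unfolding cyclic_pattern_def z_def by blast
qed

text \<open>With \<open>2 \<le> N\<close>, two-letter factors a third of a turn apart are disjoint,
  as the sign patterns require.\<close>

locale order_three_word = maximal_wicks_word +
  fixes N :: nat
  assumes three_dvd: "3 dvd order (wicks_Aut w)" and N_def: "N = length w div 3"
    and N_ge_2: "2 \<le> N"
begin

sublocale shifted_cubic_gluing "length w" "partner w" N
  unfolding N_def by (rule shiftedI[OF three_dvd])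

lemma n_eq: "n = 3 * N"
  using dvd_order_Aut(1)[OF three_dvd] by (simp add: N_def)

abbreviation centred :: "nat \<Rightarrow> nat set" where
  "centred i \<equiv> {i, i + N, i + 2 * N}"

lemma centred_iff: "i < N \<Longrightarrow> j < n \<Longrightarrow> j \<in> centred i \<longleftrightarrow> j mod N = i"
proof -
  assume i: "i < N" and j: "j < n"
  have "j div N < 3" using j n_eq by (simp add: less_mult_imp_div_less)
  then have "j div N = 0 \<or> j div N = 1 \<or> j div N = 2" by linarith
  moreover obtain q where q: "j div N = q" by simp
  moreover have "j = q * N + j mod N" using q div_mult_mod_eq[of j N] by simp
  ultimately have "j mod N = i \<Longrightarrow> j \<in> centred i" by auto
  then show ?thesis using i by auto
qed

lemma centred_mod:
  assumes "i < N"
  shows "i mod n = i" "(i + N) mod n = i + N" "(i + 2 * N) mod n = i + 2 * N"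
    "(i + N + N) mod n = i + 2 * N" "(i + N + 2 * N) mod n = i"
    "(i + 2 * N + N) mod n = i" "(i + 2 * N + 2 * N) mod n = i + N"
    "(3 * N + i) mod n = i" "(4 * N + i) mod n = i + N"
proof -
  show *: "i mod n = i" "(i + N) mod n = i + N" "(i + 2 * N) mod n = i + 2 * N"
    using assms n_eq by simp_all
  have "i + N + N = i + 2 * N" "i + N + 2 * N = i + n" "i + 2 * N + N = i + n"
    "i + 2 * N + 2 * N = i + N + n" "3 * N + i = i + n" "4 * N + i = i + N + n" using n_eq by simp_all
  then show "(i + N + N) mod n = i + 2 * N" "(i + N + 2 * N) mod n = i"
    "(i + 2 * N + N) mod n = i" "(i + 2 * N + 2 * N) mod n = i + N"
    "(3 * N + i) mod n = i" "(4 * N + i) mod n = i + N"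
    using * by (simp_all only: mod_add_self2)
qed

lemma t_centred:
  assumes "t i = i + d"
  shows "t (i + N) = (i + N + d) mod n" "t (i + 2 * N) = (i + 2 * N + d) mod n"
  using t_shift_mult[of i 1] t_shift_mult[of i 2] assms by (simp_all add: add_ac)

lemma vertex_centred:
  assumes "i < N" "t i \<in> {i + N, i + 2 * N}"
  shows "same_vertex `` {i} = centred i"
proof -
  have "i < n" using assms(1) n_eq by simp
  then have V: "same_vertex `` {i} = {i, t i, t (t i)}" by (rule vertex_eq_orbit[OF card_vertices])
  have "{i, t i, t (t i)} \<subseteq> centred i"
  proof -
    have "t (t i) mod N = t (t i mod N) mod N" by (simp only: t_mod_N)
    also have "t i mod N = i" using assms by auto
    finally have "t (t i) mod N = i" using assms by auto
    then show ?thesis using centred_iff[OF assms(1) t_less, of "t i"] assms(2) by auto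
  qed
  moreover have "card (centred i) = 3" using N_pos by simp
  ultimately show ?thesis using card_orbit[OF \<open>i < n\<close>] V by (simp add: card_subset_eq)
qed

text \<open>\<open>k\<close> is \<open>N\<close> or \<open>2 * N\<close>, and both generate the same
  rotations, so the result does not depend on \<open>k\<close>. A vertex of three corners stable
  under them is a single rotation orbit.\<close>

lemma fixed_vertices_eq:
  assumes k: "k \<in> carrier (wicks_Aut w)" "group.ord (wicks_Aut w) k = 3"
  shows "fixed_vertices w k = centred ` {i. i < N \<and> t i \<in> {i + N, i + 2 * N}}"
proof -
  have "n dvd 3 * k" using ord_Aut_dvd_iff[OF k(1), of 3] k(2) by simp
  then have "N dvd k" using n_eq by simp
  then obtain m where m: "k = N * m" by blast
  have "k < 3 * N" using k(1) n_eq by (simp add: carrier_Aut)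
  then have "m < 3" using m N_pos by simp
  moreover have "k \<noteq> 0" using ord_Aut_dvd_iff[OF k(1), of 1] k(2) by (intro notI) simp
  then have "m \<noteq> 0" using m by simp
  ultimately have "m = 1 \<or> m = 2" by linarith
  then have kN: "k = N \<or> k = 2 * N" using m by auto
  have img: "(\<lambda>j. (j + k) mod n) ` centred i = centred i" if i: "i < N" for i
    using kN by (elim disjE) (auto simp: centred_mod[OF i])
  show ?thesis
  proof (intro subset_antisym subsetI)
    fix V assume "V \<in> fixed_vertices w k"
    then have V: "V \<in> wicks_vertices w" "(\<lambda>j. (j + k) mod n) ` V = V"
      by (auto simp: fixed_vertices_def)
    obtain j where j: "j < n" "V = same_vertex `` {j}" using V(1) by (rule vertexE)
    have Vj: "V = {j, t j, t (t j)}" using vertex_eq_orbit[OF card_vertices j(1)] j(2) by simp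
    define i where "i = j mod N"
    have i: "i < N" using N_pos by (simp add: i_def)
    have jc: "j \<in> centred i" using centred_iff[OF i j(1)] by (simp add: i_def)
    have fV: "(x + k) mod n \<in> V" if "x \<in> V" for x using V(2) that by blast
    have "j \<in> V" using Vj by simp
    have "centred i \<subseteq> V"
      using fV[OF \<open>j \<in> V\<close>] fV[OF fV[OF \<open>j \<in> V\<close>]] \<open>j \<in> V\<close> jc kN
      by (elim disjE insertE emptyE) (simp_all add: centred_mod[OF i])
    moreover have "card V = 3" using card_orbit[OF j(1)] Vj by simp
    moreover have "card (centred i) = 3" using N_pos by simp
    moreover have "finite V" using Vj by simp
    ultimately have Vc: "V = centred i" by (metis card_subset_eq)
    then have "(j, i) \<in> same_vertex" using j(2) by blast
    then have "(j, t i) \<in> same_vertex" using same_vertex_trans same_vertex_t i n_eq by simp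
    then have "t i \<in> centred i" using j(2) Vc by blast
    moreover have "t i \<noteq> i" using t_neq[of i] i n_eq by simp
    ultimately show "V \<in> centred ` {i. i < N \<and> t i \<in> {i + N, i + 2 * N}}" using Vc i by auto
  next
    fix V assume "V \<in> centred ` {i. i < N \<and> t i \<in> {i + N, i + 2 * N}}"
    then obtain i where i: "V = centred i" "i < N" "t i \<in> {i + N, i + 2 * N}" by blast
    have "V \<in> wicks_vertices w"
      using vertexI[of i] vertex_centred[OF i(2,3)] i(1,2) n_eq by simp
    then show "V \<in> fixed_vertices w k"
      using img[OF i(2)] i(1) by (simp add: fixed_vertices_def)
  qed
qed

text \<open>The three letters stand at positions congruent modulo \<open>N\<close>, so the distances
  \<open>0 < p < q < 3 * N\<close> are multiples of \<open>N\<close>.\<close>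

lemma pattern_positions:
  assumes i: "i < N" and pq: "0 < p" "p < q" "q < n"
    and V: "letter_at k \<in> letters_toward w (centred i)" "letter_at (k + p) \<in> letters_toward w (centred i)"
      "letter_at (k + q) \<in> letters_toward w (centred i)"
  shows "p = N" "q = 2 * N" "k mod N = i"
proof -
  have m: "j mod N = i" if "letter_at j \<in> letters_toward w (centred i)" for j
  proof -
    have "letter_at j \<in> (!) w ` centred i" using that by (simp only: letters_toward_def)
    then obtain x where x: "letter_at j = w ! x" "x \<in> centred i" by (rule imageE)
    have "x < n" using x(2) i n_eq by (elim insertE emptyE) simp_all
    then have "j mod n = x" using letter_at_eq_iff[of j x] x(1) by (simp only: mod_less simp_thms)
    then have "j mod N = x mod N" using mod_mod_N by metis
    then show ?thesis using centred_iff[OF i \<open>x < n\<close>] x(2) by (simp only:)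
  qed
  show "k mod N = i" using V(1) by (rule m)
  then have "(k + p) mod N = k mod N" "(k + q) mod N = k mod N" using V m by simp_all
  then have "N dvd p" "N dvd q" by (metis add_diff_cancel_left' le_add1 mod_eq_dvd_iff_nat)+
  then obtain x y where xy: "p = N * x" "q = N * y" by blast
  then have "0 < x" "x < y" "y < 3" using pq n_eq by auto
  then have "x = 1" "y = 2" by linarith+
  then show "p = N" "q = 2 * N" using xy by auto
qed

lemma t_of_pattern:
  assumes i: "i < N" and k: "k mod N = i" and t: "t k = (k + d) mod n"
  shows "t i = (i + d) mod n"
proof -
  have "k = i + (k div N) * N" using k by (metis add.commute div_mult_mod_eq)
  then have "t k = (t i + (k div N) * N) mod n" by (metis t_shift_mult)
  moreover have "(k + d) mod n = (i + d + (k div N) * N) mod n"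
    using \<open>k = i + (k div N) * N\<close> by (metis add.assoc add.commute)
  ultimately have "(t i + (k div N) * N) mod n = (i + d + (k div N) * N) mod n" using t by simp
  then show ?thesis using t_less[of i] by (simp only: mod_add_right_cancel) simp
qed

lemma letters_toward_centred:
  "i < N \<Longrightarrow> letters_toward w (centred i) = {letter_at i, letter_at (i + N), letter_at (i + 2 * N)}"
  using n_eq by (simp add: letters_toward_def)

text \<open>In a positive pattern \<open>linv a\<close> stands in the third factor, two thirds of a
  turn after \<open>a\<close>; the letter before \<open>linv a\<close> marks the corner to which
  \<open>t\<close> sends the end of \<open>a\<close>.\<close>

lemma positive_iff:
  assumes i: "i < N" "t i \<in> {i + N, i + 2 * N}"
  shows "positive_vertex w (centred i) \<longleftrightarrow> t i = i + 2 * N"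
proof
  assume "positive_vertex w (centred i)"
  then obtain a b c where abc: "letters_toward w (centred i) = {a, b, c}"
    "cyclic_pattern w [a, linv b] [b, linv c] [c, linv a]"
    unfolding positive_vertex_iff by (elim exE conjE)
  then obtain k p q where "2 \<le> p \<and> p + 2 \<le> q \<and> q + 2 \<le> n \<and> letter_at k = a \<and>
    letter_at (Suc k) = linv b \<and> letter_at (k + p) = b \<and> letter_at (Suc (k + p)) = linv c \<and>
    letter_at (k + q) = c \<and> letter_at (Suc (k + q)) = linv a"
    unfolding cyclic_pattern_iff by (elim exE)
  note kpq = this
  have P: "p = N" "q = 2 * N" "k mod N = i"
    by (rule pattern_positions[OF i(1), of p q k]; use kpq abc(1) in simp)+
  have "t k = (k + q) mod n" using kpq by (simp only: t_eq_iff_letter)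
  then have "t i = (i + 2 * N) mod n" using t_of_pattern[OF i(1) P(3)] P(2) by simp
  then show "t i = i + 2 * N" using i(1) n_eq by simp
next
  assume t: "t i = i + 2 * N"
  have ts: "t i = (i + 2 * N) mod n" "t (i + N) = i mod n" "t (i + 2 * N) = (i + N) mod n"
    unfolding t_centred[OF t] unfolding t centred_mod[OF i(1)] by (rule refl)+
  have bounds: "2 \<le> N" "N + 2 \<le> 2 * N" "2 * N + 2 \<le> n" using N_ge_2 n_eq by simp_all
  have "cyclic_pattern w [letter_at i, linv (letter_at (i + N))]
    [letter_at (i + N), linv (letter_at (i + 2 * N))] [letter_at (i + 2 * N), linv (letter_at i)]"
    unfolding cyclic_pattern_iff
    by (intro exI[of _ i] exI[of _ N] exI[of _ "2 * N"])
      (simp only: ts[unfolded t_eq_iff_letter] bounds simp_thms)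
  then show "positive_vertex w (centred i)"
    unfolding positive_vertex_iff using letters_toward_centred[OF i(1)] by (intro exI conjI)
qed

text \<open>In a negative pattern \<open>linv a\<close> stands in the second factor, so
  \<open>t\<close> advances by one third of a turn.\<close>

lemma negative_iff:
  assumes i: "i < N" "t i \<in> {i + N, i + 2 * N}"
  shows "negative_vertex w (centred i) \<longleftrightarrow> t i = i + N"
proof
  assume "negative_vertex w (centred i)"
  then obtain a b c where abc: "letters_toward w (centred i) = {a, b, c}"
    "cyclic_pattern w [a, linv b] [c, linv a] [b, linv c]"
    unfolding negative_vertex_iff by (elim exE conjE)
  then obtain k p q where "2 \<le> p \<and> p + 2 \<le> q \<and> q + 2 \<le> n \<and> letter_at k = a \<and>
    letter_at (Suc k) = linv b \<and> letter_at (k + p) = c \<and> letter_at (Suc (k + p)) = linv a \<and>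
    letter_at (k + q) = b \<and> letter_at (Suc (k + q)) = linv c"
    unfolding cyclic_pattern_iff by (elim exE)
  note kpq = this
  have P: "p = N" "q = 2 * N" "k mod N = i"
    by (rule pattern_positions[OF i(1), of p q k]; use kpq abc(1) in simp)+
  have "t k = (k + p) mod n" using kpq by (simp only: t_eq_iff_letter)
  then have "t i = (i + N) mod n" using t_of_pattern[OF i(1) P(3)] P(1) by simp
  then show "t i = i + N" using i(1) n_eq by simp
next
  assume t: "t i = i + N"
  have ts: "t i = (i + N) mod n" "t (i + N) = (i + 2 * N) mod n" "t (i + 2 * N) = i mod n"
    unfolding t_centred[OF t] unfolding t centred_mod[OF i(1)] by (rule refl)+
  have bounds: "2 \<le> N" "N + 2 \<le> 2 * N" "2 * N + 2 \<le> n" using N_ge_2 n_eq by simp_all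
  have "cyclic_pattern w [letter_at i, linv (letter_at (i + 2 * N))]
    [letter_at (i + N), linv (letter_at i)] [letter_at (i + 2 * N), linv (letter_at (i + N))]"
    unfolding cyclic_pattern_iff
    by (intro exI[of _ i] exI[of _ N] exI[of _ "2 * N"])
      (simp only: ts[unfolded t_eq_iff_letter] bounds simp_thms)
  moreover have "letters_toward w (centred i)
    = {letter_at i, letter_at (i + 2 * N), letter_at (i + N)}"
    unfolding letters_toward_centred[OF i(1)] by (simp only: insert_commute)
  ultimately show "negative_vertex w (centred i)"
    unfolding negative_vertex_iff by (intro exI conjI)
qed

lemma inj_on_centred: "inj_on centred {..<N}"
proof (rule inj_onI)
  fix i j assume ij: "i \<in> {..<N}" "j \<in> {..<N}" "centred i = centred j"
  then have "i \<in> centred j" by blast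
  then show "i = j" using ij by auto
qed

text \<open>Every fixed vertex has exactly one corner below \<open>N\<close>, while
  \<open>turned_corners\<close> counts all three of its corners.\<close>

lemma card_fixed_vertices:
  assumes k: "k \<in> carrier (wicks_Aut w)" "group.ord (wicks_Aut w) k = 3"
  shows "3 * card {V \<in> fixed_vertices w k. positive_vertex w V} = turned_corners w (2 * N)"
    and "3 * card {V \<in> fixed_vertices w k. negative_vertex w V} = turned_corners w N"
proof -
  have *: "card (centred ` {i. i < N \<and> t i = i + d}) = card {i. i < N \<and> t i = (i + d) mod n}"
    if "d \<in> {N, 2 * N}" for d
  proof -
    have "{i. i < N \<and> t i = i + d} = {i. i < N \<and> t i = (i + d) mod n}"
      using that n_eq by auto
    moreover have "inj_on centred {i. i < N \<and> t i = i + d}"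
      by (rule inj_on_subset[OF inj_on_centred]) auto
    ultimately show ?thesis by (simp only: card_image)
  qed
  have "{V \<in> fixed_vertices w k. positive_vertex w V} = centred ` {i. i < N \<and> t i = i + 2 * N}"
    unfolding fixed_vertices_eq[OF k] using positive_iff by auto
  then show "3 * card {V \<in> fixed_vertices w k. positive_vertex w V} = turned_corners w (2 * N)"
    using *[of "2 * N"] turned_corners_quotient[OF three_dvd, of "2 * N"] by (simp add: N_def)
  have "{V \<in> fixed_vertices w k. negative_vertex w V} = centred ` {i. i < N \<and> t i = i + N}"
    unfolding fixed_vertices_eq[OF k] using negative_iff by auto
  then show "3 * card {V \<in> fixed_vertices w k. negative_vertex w V} = turned_corners w N"
    using *[of N] turned_corners_quotient[OF three_dvd, of N] by (simp add: N_def)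
qed

end

section \<open>Counting classes\<close>

text \<open>The Riemann-Hurwitz formula, with \<open>h\<close> the genus of the quotient. The
  congruence makes \<open>2 * g + 1 - r\<close> divisible by 4, the bound makes it
  nonnegative.\<close>

lemma order_two_arith:
  fixes g r :: nat
  assumes "1 \<le> g" "[r = 6 * g - 3] (mod 4)" "3 * r \<le> 6 * g - 3 + 6"
  shows "\<exists>h. 2 * g + 1 = r + 4 * h"
proof -
  obtain z where "int (6 * g - 3) - int r = 4 * z"
    using assms(2) by (metis cong_iff_dvd_diff cong_int_iff cong_sym_eq dvdE of_nat_numeral)
  then have "2 * g + 1 = r + 4 * nat (z - int g + 1)" using assms(1,3) by linarith
  then show ?thesis ..
qed

text \<open>\<open>a\<close> and \<open>b\<close> count negative and positive fixed vertices,
  \<open>q\<close> the other vertices of the quotient. The bound gives \<open>h \<ge> 0\<close>;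
  eliminating \<open>a\<close> modulo 3 gives the congruence for \<open>b\<close>.\<close>

lemma order_three_arith:
  fixes g a b q :: nat
  assumes "1 \<le> g" "[int a + 1 = int b] (mod 3)" "4 * g - 2 = a + b + 3 * q"
    and "4 * a + 4 * b \<le> 4 * g - 2 + 6"
  shows "\<exists>h. g + 1 = b + a + 3 * h" "[b = 2 * g + 1] (mod 3)"
proof -
  have "g + 1 = b + a + 3 * nat (int q - int g + 1)" using assms(1,3,4) by linarith
  then show "\<exists>h. g + 1 = b + a + 3 * h" ..
  obtain z where "int a + 1 - int b = 3 * z"
    using assms(2) by (metis cong_iff_dvd_diff dvdE)
  then have "int b - int (2 * g + 1) = 3 * int b - 6 * int g + 3 * z + 3 * int q"
    using assms(1,3) by linarith
  also have "\<dots> = 3 * (int b - 2 * int g + z + int q)" by simp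
  finally show "[b = 2 * g + 1] (mod 3)"
    by (metis cong_iff_dvd_diff cong_int_iff dvd_triv_left of_nat_numeral)
qed

text \<open>Divisibility by 12 combines the formulas for the quotients by rotations of order 2 and
  3; nonnegativity is the spanning tree bound for the quotient of order 6.\<close>

lemma order_six_arith:
  fixes g a b r h h' :: nat
  assumes "1 \<le> g" "2 * g + 1 = 3 * r + 4 * h" "g + 1 = 2 * b + 2 * a + 3 * h'"
    and "4 * a + 4 * b + 3 * r \<le> 2 * g - 1 + 6"
  shows "\<exists>k. 2 * g + 5 = 3 * r + 4 * b + 4 * a + 12 * k"
proof -
  have "2 * g + 5 = 3 * r + 4 * b + 4 * a + 12 * nat (2 * int h' - int r - int h + int a + int b)"
    using assms by linarith
  then show ?thesis ..
qed

text \<open>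
  These count sides and corners, that is, twice the number of edges reversed by a rotation of order 2
  and three times the number of vertices of either sign fixed by a rotation of order 3.
\<close>

definition half_turns :: "letter list \<Rightarrow> nat" where
  "half_turns w = turned_sides w (length w div 2)"

definition positive_turns :: "letter list \<Rightarrow> nat" where
  "positive_turns w = turned_corners w (2 * (length w div 3))"

definition negative_turns :: "letter list \<Rightarrow> nat" where
  "negative_turns w = turned_corners w (length w div 3)"

lemma turns_invariant:
  assumes "wicks_word w" "(w, w') \<in> wicks_equiv"
  shows "half_turns w' = half_turns w" "positive_turns w' = positive_turns w"
    "negative_turns w' = negative_turns w"
  using turned_sides_invariant[OF assms] turned_corners_invariant[OF assms] wicks_equivD(2)[OF assms]
  by (simp_all add: half_turns_def positive_turns_def negative_turns_def)

context
  fixes g :: nat and w :: "letter list"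
  assumes w: "w \<in> maximal_wicks_forms g" and g: "1 \<le> g"
begin

interpretation maximal_wicks_word w
  by (rule maximal_wicks_wordI(1)[OF w g])

lemma length_eq: "length w = 6 * (2 * g - 1)"
  by (rule maximal_wicks_wordI(2)[OF w g])

text \<open>No side is its own partner, so the loops of the quotient are the sides glued to their
  opposites. \<open>N = 6 * g - 3\<close> is odd, as \<open>loops_parity\<close> demands.\<close>

lemma order_two_genus:
  assumes "2 dvd order (wicks_Aut w)"
  shows "\<exists>r h. half_turns w = 2 * r \<and> 2 * g + 1 = r + 4 * h"
proof -
  define N where "N = n div 2"
  interpret sh: shifted_cubic_gluing n "partner w" N unfolding N_def by (rule shiftedI[OF assms])
  have n: "n = 2 * N" "N = 6 * g - 3" using length_eq g by (simp_all add: N_def)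
  define r where "r = card {i. i < N \<and> partner w i = (i + N) mod n}"
  have R: "half_turns w = 2 * r"
    unfolding half_turns_def r_def N_def by (rule turned_sides_quotient[OF assms])
  have "sh.quot.loops = {i. i < N \<and> partner w i = (i + N) mod n}"
  proof (intro subset_antisym subsetI)
    fix i assume "i \<in> sh.quot.loops"
    then have i: "i < N" "partner w i mod N = i" by (auto simp: sh.quot.loops_def)
    have "partner w i \<noteq> i" using partner_neq[of i] i n by simp
    then have "N \<le> partner w i" using i(2) mod_less by (metis not_le)
    then have "partner w i - N < N" using partner_less[of i] n by simp
    then have "partner w i = i + N" using i(2) \<open>N \<le> partner w i\<close>
      by (metis le_add_diff_inverse2 le_mod_geq mod_less)
    then show "i \<in> {i. i < N \<and> partner w i = (i + N) mod n}" using i n by simp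
  next
    fix i assume "i \<in> {i. i < N \<and> partner w i = (i + N) mod n}"
    then have "i < N" "partner w i = i + N" using n(1) by auto
    then show "i \<in> sh.quot.loops" by (simp add: sh.quot.loops_def)
  qed
  then have r: "card sh.quot.loops = r" by (simp add: r_def)
  have "odd N" using n g by presburger
  then have "[r = N] (mod 4)" using sh.quot.loops_parity r by simp
  moreover have "3 * r \<le> N + 6" using sh.quot.spanning_tree_bound r by simp
  ultimately have "\<exists>h. 2 * g + 1 = r + 4 * h" using order_two_arith g n(2) by simp
  then show ?thesis using R by blast
qed

lemma order_three_genus:
  assumes "3 dvd order (wicks_Aut w)"
  shows "\<exists>s t h. positive_turns w = 3 * s \<and> negative_turns w = 3 * t \<and> g + 1 = s + t + 3 * h \<and>
    [s = 2 * g + 1] (mod 3)"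
proof -
  define N where "N = n div 3"
  interpret sh: shifted_cubic_gluing n "partner w" N unfolding N_def by (rule shiftedI[OF assms])
  have n: "n = 3 * N" "N = 4 * g - 2" using length_eq g by (simp_all add: N_def)
  define a where "a = card {i. i < N \<and> t i = (i + N) mod n}"
  define b where "b = card {i. i < N \<and> t i = (i + 2 * N) mod n}"
  have ab: "positive_turns w = 3 * b" "negative_turns w = 3 * a"
    unfolding positive_turns_def negative_turns_def a_def b_def N_def
    by (rule turned_corners_quotient[OF assms])+
  have cong: "[int a + 1 = int b] (mod 3)" and leaves: "card sh.quot.leaves = a + b"
    using sh.signed_leaves[OF n(1) t_neq] unfolding a_def b_def by blast+
  have "4 * g - 2 = a + b + 3 * card sh.quot.orbit_minima"
    using sh.quot.card_orbits leaves n(2) by metis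
  moreover have "4 * a + 4 * b \<le> 4 * g - 2 + 6"
    using sh.quot.spanning_tree_bound unfolding leaves n(2)[symmetric] by simp
  ultimately show ?thesis using order_three_arith[OF g cong] ab by blast
qed

lemma order_six_genus:
  assumes "6 dvd order (wicks_Aut w)"
  shows "\<exists>r s t h. half_turns w = 2 * (3 * r) \<and> positive_turns w = 3 * (2 * s) \<and>
    negative_turns w = 3 * (2 * t) \<and> 2 * g + 5 = 3 * r + 4 * s + 4 * t + 12 * h \<and>
    [2 * s = 2 * g + 1] (mod 3)"
proof -
  define N where "N = n div 6"
  interpret sh: shifted_cubic_gluing n "partner w" N unfolding N_def by (rule shiftedI[OF assms])
  have n: "n = 6 * N" "N = 2 * g - 1" "n div 2 = 3 * N" "n div 3 = 2 * N"
    using length_eq g by (simp_all add: N_def)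
  define A where "A = {i. i < N \<and> t i = (i + 2 * N) mod n}"
  define B where "B = {i. i < N \<and> t i = (i + 2 * (2 * N)) mod n}"
  define R where "R = {i. i < N \<and> partner w i = (i + 3 * N) mod n}"
  \<comment> \<open>A half turn is \<open>3 * N\<close> and a third of a turn is
    \<open>2 * N\<close>; a count over a sixth of the polygon is multiplied by 6.\<close>
  have half: "half_turns w = 6 * card R"
    using turned_sides_quotient[OF assms, of "3 * N"]
    unfolding half_turns_def n(3) R_def N_def[symmetric] by (simp only:)
  have pos: "positive_turns w = 6 * card B"
    using turned_corners_quotient[OF assms, of "2 * (2 * N)"]
    unfolding positive_turns_def n(4) B_def N_def[symmetric] by (simp only:)
  have neg: "negative_turns w = 6 * card A"
    using turned_corners_quotient[OF assms, of "2 * N"]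
    unfolding negative_turns_def n(4) A_def N_def[symmetric] by (simp only:)
  note turns = half pos neg
  \<comment> \<open>Inequalities suffice, since loops and leaves enter only through the spanning
    tree bound.\<close>
  moreover have "card R \<le> card sh.quot.loops"
    by (rule card_mono) (use n(1) in \<open>auto simp: R_def sh.quot.loops_def\<close>)
  moreover have "card A + card B \<le> card sh.quot.leaves"
  proof -
    have "A \<inter> B = {}" using n(1) sh.N_pos by (auto simp: A_def B_def)
    then have "card A + card B = card (A \<union> B)"
      by (intro card_Un_disjoint[symmetric]) (auto simp: A_def B_def)
    also have "\<dots> \<le> card sh.quot.leaves"
      by (rule card_mono) (use n(1) in \<open>auto simp: A_def B_def sh.quot.leaves_def\<close>)
    finally show ?thesis .
  qed
  moreover have "4 * card sh.quot.leaves + 3 * card sh.quot.loops \<le> N + 6"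
    by (rule sh.quot.spanning_tree_bound)
  moreover have "2 dvd order (wicks_Aut w)" "3 dvd order (wicks_Aut w)"
    using assms by (auto elim: dvd_trans[rotated])
  moreover note order_two_genus order_three_genus
  \<comment> \<open>The counts \<open>6 * card R\<close>, \<open>6 * card B\<close>,
    \<open>6 * card A\<close> amount to \<open>3 * card R\<close> reversed edges,
    \<open>2 * card B\<close> positive and \<open>2 * card A\<close> negative fixed
    vertices.\<close>
  ultimately obtain h h' where h: "2 * g + 1 = 3 * card R + 4 * h"
      "g + 1 = 2 * card B + 2 * card A + 3 * h'"
    and cong: "[2 * card B = 2 * g + 1] (mod 3)"
    and bound: "4 * card A + 4 * card B + 3 * card R \<le> N + 6"
    by (auto simp: mult_left_cancel)
  obtain k where "2 * g + 5 = 3 * card R + 4 * card B + 4 * card A + 12 * k"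
    using order_six_arith[OF g h] bound n(2) by auto
  then show ?thesis
    using cong turns
    by (intro exI[of _ "card R"] exI[of _ "card B"] exI[of _ "card A"] exI[of _ k]) simp
qed

text \<open>Turns the condition defining \<open>W2\<close> into one on invariants of the
  class.\<close>

lemma W2_condition_iff:
  "(\<exists>k \<in> carrier (wicks_Aut w). \<exists>\<phi>. group.ord (wicks_Aut w) k = 2 \<and>
     relabelling \<phi> w (rotate k w) \<and> card (reversed_edges w \<phi>) = r) \<longleftrightarrow>
   2 dvd order (wicks_Aut w) \<and> half_turns w = 2 * r" (is "?L \<longleftrightarrow> ?R")
proof
  assume ?L
  then obtain k \<phi> where k: "k \<in> carrier (wicks_Aut w)" "group.ord (wicks_Aut w) k = 2"
    "relabelling \<phi> w (rotate k w)" "card (reversed_edges w \<phi>) = r" by (elim bexE exE conjE)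
  have "2 dvd order (wicks_Aut w)" using ord_Aut_dvd_order[OF k(1)] k(2) by simp
  then show ?R using card_reversed_edges[OF _ k(1-3)] k(4) by (simp add: half_turns_def)
next
  assume R: ?R
  let ?k = "n div 2"
  have k: "?k \<in> carrier (wicks_Aut w)" "group.ord (wicks_Aut w) ?k = 2"
    using div_in_carrier_Aut[of 2] R by auto
  then obtain \<phi> where \<phi>: "relabelling \<phi> w (rotate ?k w)" by (auto simp: wicks_Aut_def)
  have "card (reversed_edges w \<phi>) = r"
    using card_reversed_edges[OF _ k \<phi>] R by (simp add: half_turns_def)
  then show ?L using k \<phi> by blast
qed

lemma W3_condition_iff:
  "(\<exists>k \<in> carrier (wicks_Aut w). group.ord (wicks_Aut w) k = 3 \<and>
     card {V \<in> fixed_vertices w k. positive_vertex w V} = p \<and>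
     card {V \<in> fixed_vertices w k. negative_vertex w V} = q) \<longleftrightarrow>
   3 dvd order (wicks_Aut w) \<and> positive_turns w = 3 * p \<and> negative_turns w = 3 * q" (is "?L \<longleftrightarrow> ?R")
proof -
  have *: "3 * card {V \<in> fixed_vertices w k. positive_vertex w V} = positive_turns w \<and>
    3 * card {V \<in> fixed_vertices w k. negative_vertex w V} = negative_turns w"
    if "3 dvd order (wicks_Aut w)" "k \<in> carrier (wicks_Aut w)" "group.ord (wicks_Aut w) k = 3" for k
  proof -
    interpret order_three_word w "n div 3"
      by unfold_locales (use that length_eq g in auto)
    show ?thesis using card_fixed_vertices[OF that(2,3)]
      by (simp add: positive_turns_def negative_turns_def)
  qed
  show ?thesis
  proof
    assume ?L
    then obtain k where k: "k \<in> carrier (wicks_Aut w)" "group.ord (wicks_Aut w) k = 3"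
      "card {V \<in> fixed_vertices w k. positive_vertex w V} = p"
      "card {V \<in> fixed_vertices w k. negative_vertex w V} = q" by (elim bexE conjE)
    have "3 dvd order (wicks_Aut w)" using ord_Aut_dvd_order[OF k(1)] k(2) by simp
    then show ?R using *[OF _ k(1,2)] k(3,4) by simp
  next
    assume R: ?R
    then have k: "n div 3 \<in> carrier (wicks_Aut w)" "group.ord (wicks_Aut w) (n div 3) = 3"
      using div_in_carrier_Aut[of 3] by auto
    show ?L using *[OF _ k] k R by (intro bexI[OF _ k(1)]) simp
  qed
qed

end

section \<open>Equivalence classes and their representatives\<close>

abbreviation class_rep :: "letter list set \<Rightarrow> letter list" where
  "class_rep C \<equiv> SOME w. w \<in> C"

lemma maximal_wicks_word: "w \<in> maximal_wicks_forms g \<Longrightarrow> 1 \<le> g \<Longrightarrow> wicks_word w"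
  by (meson maximal_wicks_wordI(1) maximal_wicks_word.axioms(1))

lemma class_rep_equiv:
  assumes "wicks_word x"
  shows "(x, class_rep (wicks_equiv `` {x})) \<in> wicks_equiv"
proof -
  have "x \<in> wicks_equiv `` {x}" using wicks_equiv_refl[OF assms] by simp
  then have "class_rep (wicks_equiv `` {x}) \<in> wicks_equiv `` {x}" by (rule someI)
  then show ?thesis by simp
qed

lemma W1E:
  assumes "C \<in> W1 g" "1 \<le> g"
  obtains x where "x \<in> maximal_wicks_forms g" "wicks_word x" "C = wicks_equiv `` {x}"
    "(x, class_rep C) \<in> wicks_equiv"
proof -
  obtain x where x: "x \<in> maximal_wicks_forms g" "C = wicks_equiv `` {x}"
    using assms(1) unfolding W1_def by (rule quotientE)
  have "wicks_word x" using maximal_wicks_word x(1) assms(2) by blast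
  then show ?thesis using that[OF x(1) _ x(2)] class_rep_equiv x(2) by simp
qed

text \<open>An invariant property can be tested on the representative at which \<open>mass\<close>
  evaluates; all sets of classes thereby become subsets of \<open>W1 g\<close>.\<close>

lemma quotient_filter:
  assumes "1 \<le> g" "\<And>w w'. wicks_word w \<Longrightarrow> (w, w') \<in> wicks_equiv \<Longrightarrow> F w' \<longleftrightarrow> F w"
  shows "{w \<in> maximal_wicks_forms g. F w} // wicks_equiv = {C \<in> W1 g. F (class_rep C)}"
proof (intro subset_antisym subsetI)
  fix C assume "C \<in> {w \<in> maximal_wicks_forms g. F w} // wicks_equiv"
  then obtain x where x: "x \<in> {w \<in> maximal_wicks_forms g. F w}" "C = wicks_equiv `` {x}"
    by (rule quotientE)
  then have "C \<in> W1 g" unfolding W1_def by (simp add: quotientI)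
  moreover have "wicks_word x" using maximal_wicks_word[of x g] x(1) assms(1) by simp
  then have "F (class_rep C)" using assms(2)[OF _ class_rep_equiv] x by simp
  ultimately show "C \<in> {C \<in> W1 g. F (class_rep C)}" by simp
next
  fix C assume "C \<in> {C \<in> W1 g. F (class_rep C)}"
  then have C: "C \<in> W1 g" "F (class_rep C)" by auto
  then obtain x where x: "x \<in> maximal_wicks_forms g" "wicks_word x" "C = wicks_equiv `` {x}"
    "(x, class_rep C) \<in> wicks_equiv" using W1E assms(1) by metis
  then have "F x" using assms(2)[OF x(2,4)] C(2) by simp
  then show "C \<in> {w \<in> maximal_wicks_forms g. F w} // wicks_equiv"
    using x by (simp add: quotientI)
qed

text \<open>The alphabet is infinite, but a class is determined by the gluing of its representative,
  recorded by \<open>f\<close> as a relation on \<open>{..<m}\<close>.\<close>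

lemma finite_W1:
  assumes "1 \<le> g"
  shows "finite (W1 g)"
proof -
  define m where "m = 6 * (2 * g - 1)"
  define f where "f C = {(i, j). i < m \<and> j < m \<and> partner (class_rep C) i = j}" for C
  have "inj_on f (W1 g)"
  proof (rule inj_onI)
    fix C C' assume C: "C \<in> W1 g" and C': "C' \<in> W1 g" and eq: "f C = f C'"
    obtain x where x: "x \<in> maximal_wicks_forms g" "wicks_word x" "C = wicks_equiv `` {x}"
      "(x, class_rep C) \<in> wicks_equiv" using W1E[OF C assms] .
    obtain x' where x': "x' \<in> maximal_wicks_forms g" "wicks_word x'" "C' = wicks_equiv `` {x'}"
      "(x', class_rep C') \<in> wicks_equiv" using W1E[OF C' assms] .
    note D = wicks_equivD[OF x(2,4)] and D' = wicks_equivD[OF x'(2,4)]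
    have len: "length (class_rep C) = m" "length (class_rep C') = m"
      using D(2) D'(2) maximal_wicks_wordI(2)[OF x(1) assms] maximal_wicks_wordI(2)[OF x'(1) assms]
      by (simp_all add: m_def)
    interpret c: gluing m "partner (class_rep C)" using wicks_word_gluing[OF D(1)] len by simp
    interpret c': gluing m "partner (class_rep C')" using wicks_word_gluing[OF D'(1)] len by simp
    have "partner (class_rep C) i = partner (class_rep C') i" for i
    proof -
      have "(i mod m, partner (class_rep C) (i mod m)) \<in> f C"
        unfolding f_def using c.n_pos c.s_less by simp
      then have "(i mod m, partner (class_rep C) (i mod m)) \<in> f C'" by (simp only: eq)
      then have "partner (class_rep C') (i mod m) = partner (class_rep C) (i mod m)"
        by (simp add: f_def)
      then show ?thesis by (simp add: c.s_mod c'.s_mod)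
    qed
    then have "shift_conj m (partner (class_rep C)) (partner (class_rep C')) 0"
      by (simp add: shift_conj_def c'.s_less)
    then have cc: "(class_rep C, class_rep C') \<in> wicks_equiv"
      using wicks_equivI[OF D(1) D'(1)] len by simp
    have "(class_rep C', x') \<in> wicks_equiv" using wicks_equiv_sym[OF x'(2,4)] .
    then have xx: "(x, x') \<in> wicks_equiv"
      using wicks_equiv_trans[OF x(2)] x(4) cc by blast
    then have "(x', x) \<in> wicks_equiv" using wicks_equiv_sym[OF x(2)] by blast
    then show "C = C'" unfolding x(3) x'(3)
      using xx wicks_equiv_trans[OF x(2)] wicks_equiv_trans[OF x'(2)] by blast
  qed
  moreover have "f ` W1 g \<subseteq> Pow ({..<m} \<times> {..<m})" by (auto simp: f_def)
  ultimately show ?thesis by (meson finite_Pow_iff finite_SigmaI finite_imageD finite_lessThan finite_subset)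
qed

text \<open>After exchanging the sums, each \<open>C\<close> is counted once, at its only
  index.\<close>

lemma sum_by_key:
  fixes h :: "'b \<Rightarrow> 'c::comm_monoid_add"
  assumes "finite A" "finite S" "\<And>C. C \<in> S \<Longrightarrow> \<exists>!r. r \<in> A \<and> key r C"
  shows "(\<Sum>r\<in>A. \<Sum>C | C \<in> S \<and> key r C. h C) = (\<Sum>C\<in>S. h C)"
proof -
  have "(\<Sum>r\<in>A. \<Sum>C | C \<in> S \<and> key r C. h C) = (\<Sum>r\<in>A. \<Sum>C\<in>S. if key r C then h C else 0)"
    by (simp add: sum.inter_filter[OF assms(2), symmetric])
  also have "\<dots> = (\<Sum>C\<in>S. \<Sum>r\<in>A. if key r C then h C else 0)" by (rule sum.swap)
  also have "\<dots> = (\<Sum>C\<in>S. h C)"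
  proof (rule sum.cong[OF refl])
    fix C assume "C \<in> S"
    then have "\<exists>!r. r \<in> A \<and> key r C" by (rule assms(3))
    then obtain r where r: "r \<in> A" "\<forall>r'\<in>A. key r' C \<longleftrightarrow> r' = r" by blast
    have "(\<Sum>r'\<in>A. if key r' C then h C else 0) = (\<Sum>r'\<in>A. if r' = r then h C else 0)"
      using r(2) by (intro sum.cong refl) simp
    then show "(\<Sum>r'\<in>A. if key r' C then h C else 0) = h C" using assms(1) r(1) by simp
  qed
  finally show ?thesis .
qed

lemma div_in_Nats_iff:
  assumes "0 < c"
  shows "(real a - real b) / real c \<in> \<nat> \<longleftrightarrow> (\<exists>h. a = b + c * h)"
proof -
  have "(real a - real b) / real c = real h \<longleftrightarrow> a = b + c * h" for h
  proof -
    have "(real a - real b) / real c = real h \<longleftrightarrow> real a = real (b + c * h)"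
      using assms by (auto simp: field_simps)
    then show ?thesis by (simp only: of_nat_eq_iff)
  qed
  then show ?thesis by (auto simp: Nats_def)
qed

section \<open>The masses as sums over classes\<close>

context
  fixes g :: nat
  assumes g: "1 \<le> g"
begin

abbreviation class_order :: "letter list set \<Rightarrow> nat" where
  "class_order C \<equiv> order (wicks_Aut (class_rep C))"

lemma M_eq: "M d g = card {C \<in> W1 g. d dvd class_order C}"
  unfolding M_def by (subst quotient_filter[OF g]) (auto simp: order_Aut_invariant)

lemma W2_eq: "W2 g r = {C \<in> W1 g. 2 dvd class_order C \<and> half_turns (class_rep C) = 2 * r}"
proof -
  have "{w \<in> maximal_wicks_forms g. \<exists>k \<in> carrier (wicks_Aut w). \<exists>\<phi>.
     group.ord (wicks_Aut w) k = 2 \<and> relabelling \<phi> w (rotate k w) \<and> card (reversed_edges w \<phi>) = r}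
    = {w \<in> maximal_wicks_forms g. 2 dvd order (wicks_Aut w) \<and> half_turns w = 2 * r}"
    using W2_condition_iff[OF _ g] by blast
  then show ?thesis
    unfolding W2_def by (simp only:) (rule quotient_filter[OF g], simp add: order_Aut_invariant turns_invariant)
qed

lemma W3_eq: "W3 g s t = {C \<in> W1 g. 3 dvd class_order C \<and>
  positive_turns (class_rep C) = 3 * s \<and> negative_turns (class_rep C) = 3 * t}"
proof -
  have "{w \<in> maximal_wicks_forms g. \<exists>k \<in> carrier (wicks_Aut w). group.ord (wicks_Aut w) k = 3 \<and>
     card {V \<in> fixed_vertices w k. positive_vertex w V} = s \<and>
     card {V \<in> fixed_vertices w k. negative_vertex w V} = t}
    = {w \<in> maximal_wicks_forms g. 3 dvd order (wicks_Aut w) \<and> positive_turns w = 3 * s \<and>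
      negative_turns w = 3 * t}"
    using W3_condition_iff[OF _ g] by blast
  then show ?thesis
    unfolding W3_def by (simp only:) (rule quotient_filter[OF g], simp add: order_Aut_invariant turns_invariant)
qed

text \<open>Facts about a form \<open>x\<close> of genus \<open>g\<close> in the class pass to the
  representative through the invariants; the genus of the representative itself is never
  computed.\<close>

lemma class_genus:
  assumes "C \<in> W1 g"
  shows "class_order C \<in> {1, 2, 3, 6}"
    and "2 dvd class_order C \<Longrightarrow> \<exists>r h. half_turns (class_rep C) = 2 * r \<and> 2 * g + 1 = r + 4 * h"
    and "3 dvd class_order C \<Longrightarrow> \<exists>s t h. positive_turns (class_rep C) = 3 * s \<and>
      negative_turns (class_rep C) = 3 * t \<and> g + 1 = s + t + 3 * h \<and> [s = 2 * g + 1] (mod 3)"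
    and "6 dvd class_order C \<Longrightarrow> \<exists>r s t h. half_turns (class_rep C) = 2 * (3 * r) \<and>
      positive_turns (class_rep C) = 3 * (2 * s) \<and> negative_turns (class_rep C) = 3 * (2 * t) \<and>
      2 * g + 5 = 3 * r + 4 * s + 4 * t + 12 * h \<and> [2 * s = 2 * g + 1] (mod 3)"
proof -
  obtain x where x: "x \<in> maximal_wicks_forms g" "wicks_word x" "(x, class_rep C) \<in> wicks_equiv"
    using W1E[OF assms g] by metis
  note inv = order_Aut_invariant[OF x(2,3)] turns_invariant[OF x(2,3)]
  have "order (wicks_Aut x) dvd 6"
    using maximal_wicks_word.order_Aut_dvd_6[OF maximal_wicks_wordI(1)[OF x(1) g]] .
  moreover from this have "order (wicks_Aut x) \<le> 6" by (rule dvd_imp_le) simp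
  then have "order (wicks_Aut x) \<in> {0, 1, 2, 3, 4, 5, 6}" by auto
  ultimately show "class_order C \<in> {1, 2, 3, 6}" unfolding inv by auto
  show "2 dvd class_order C \<Longrightarrow> \<exists>r h. half_turns (class_rep C) = 2 * r \<and> 2 * g + 1 = r + 4 * h"
    unfolding inv by (rule order_two_genus[OF x(1) g])
  show "3 dvd class_order C \<Longrightarrow> \<exists>s t h. positive_turns (class_rep C) = 3 * s \<and>
      negative_turns (class_rep C) = 3 * t \<and> g + 1 = s + t + 3 * h \<and> [s = 2 * g + 1] (mod 3)"
    unfolding inv by (rule order_three_genus[OF x(1) g])
  show "6 dvd class_order C \<Longrightarrow> \<exists>r s t h. half_turns (class_rep C) = 2 * (3 * r) \<and>
      positive_turns (class_rep C) = 3 * (2 * s) \<and> negative_turns (class_rep C) = 3 * (2 * t) \<and>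
      2 * g + 5 = 3 * r + 4 * s + 4 * t + 12 * h \<and> [2 * s = 2 * g + 1] (mod 3)"
    unfolding inv by (rule order_six_genus[OF x(1) g])
qed

text \<open>A class determines \<open>r\<close> by its half turns, and \<open>class_genus\<close>
  places this \<open>r\<close> in the index set, so each class of even order is counted exactly
  once. The same reasoning serves \<open>m3\<close> and \<open>m6\<close>.\<close>

lemma m2_eq: "m2 g = (\<Sum>C | C \<in> W1 g \<and> 2 dvd class_order C. 1 / real (class_order C))"
proof -
  define A where "A = {r. (2 * real g + 1 - real r) / 4 \<in> \<nat>}"
  have A: "A = {r. \<exists>h. 2 * g + 1 = r + 4 * h}"
  proof -
    have "(2 * real g + 1 - real r) / 4 = (real (2 * g + 1) - real r) / real 4" for r by simp
    then show ?thesis unfolding A_def by (simp only: div_in_Nats_iff zero_less_numeral)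
  qed
  have "finite A" unfolding A by (rule finite_subset[of _ "{..2 * g + 1}"]) auto
  moreover have "finite {C \<in> W1 g. 2 dvd class_order C}" using finite_W1[OF g] by simp
  moreover have "\<exists>!r. r \<in> A \<and> half_turns (class_rep C) = 2 * r"
    if "C \<in> {C \<in> W1 g. 2 dvd class_order C}" for C
    using class_genus(2)[of C] that unfolding A by auto
  ultimately have "(\<Sum>r\<in>A. \<Sum>C | C \<in> {C \<in> W1 g. 2 dvd class_order C} \<and> half_turns (class_rep C) = 2 * r.
      1 / real (class_order C)) = (\<Sum>C\<in>{C \<in> W1 g. 2 dvd class_order C}. 1 / real (class_order C))"
    by (rule sum_by_key)
  then show ?thesis by (simp add: m2_def mass_def W2_eq A_def conj_assoc)
qed

lemma m3_eq: "m3 g = (\<Sum>C | C \<in> W1 g \<and> 3 dvd class_order C. 1 / real (class_order C))"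
proof -
  define A where "A = {(s, t). (real g + 1 - real s - real t) / 3 \<in> \<nat> \<and> [s = 2 * g + 1] (mod 3)}"
  have A: "A = {(s, t). (\<exists>h. g + 1 = s + t + 3 * h) \<and> [s = 2 * g + 1] (mod 3)}"
  proof -
    have "(real g + 1 - real s - real t) / 3 = (real (g + 1) - real (s + t)) / real 3" for s t by simp
    then show ?thesis unfolding A_def by (simp only: div_in_Nats_iff zero_less_numeral)
  qed
  have "finite A" unfolding A by (rule finite_subset[of _ "{..g + 1} \<times> {..g + 1}"]) auto
  moreover have "finite {C \<in> W1 g. 3 dvd class_order C}" using finite_W1[OF g] by simp
  moreover have "\<exists>!x. x \<in> A \<and> positive_turns (class_rep C) = 3 * fst x \<and>
      negative_turns (class_rep C) = 3 * snd x"
    if "C \<in> {C \<in> W1 g. 3 dvd class_order C}" for C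
    using class_genus(3)[of C] that unfolding A by fastforce
  ultimately have "(\<Sum>x\<in>A. \<Sum>C | C \<in> {C \<in> W1 g. 3 dvd class_order C} \<and>
      (positive_turns (class_rep C) = 3 * fst x \<and> negative_turns (class_rep C) = 3 * snd x).
      1 / real (class_order C)) = (\<Sum>C\<in>{C \<in> W1 g. 3 dvd class_order C}. 1 / real (class_order C))"
    by (rule sum_by_key)
  then show ?thesis by (simp add: m3_def mass_def W3_eq A_def conj_assoc case_prod_beta)
qed

lemma W6_eq: "W6 g r s t = {C \<in> W1 g. 6 dvd class_order C \<and> half_turns (class_rep C) = 2 * r \<and>
  positive_turns (class_rep C) = 3 * s \<and> negative_turns (class_rep C) = 3 * t}"
proof -
  have "6 dvd k \<longleftrightarrow> 2 dvd k \<and> 3 dvd k" for k :: nat by presburger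
  then show ?thesis unfolding W6_def W2_eq W3_eq by auto
qed

lemma m6_eq: "m6 g = (\<Sum>C | C \<in> W1 g \<and> 6 dvd class_order C. 1 / real (class_order C))"
proof -
  define A where "A = {(r, s, t). (2 * real g + 5 - 3 * real r - 4 * real s - 4 * real t) / 12 \<in> \<nat> \<and>
     [2 * s = 2 * g + 1] (mod 3)}"
  have A: "A = {(r, s, t). (\<exists>h. 2 * g + 5 = 3 * r + 4 * s + 4 * t + 12 * h) \<and> [2 * s = 2 * g + 1] (mod 3)}"
  proof -
    have "(2 * real g + 5 - 3 * real r - 4 * real s - 4 * real t) / 12
      = (real (2 * g + 5) - real (3 * r + 4 * s + 4 * t)) / real 12" for r s t by simp
    then show ?thesis unfolding A_def by (simp only: div_in_Nats_iff zero_less_numeral)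
  qed
  have "finite A" unfolding A
    by (rule finite_subset[of _ "{..2 * g + 5} \<times> {..2 * g + 5} \<times> {..2 * g + 5}"]) auto
  moreover have "finite {C \<in> W1 g. 6 dvd class_order C}" using finite_W1[OF g] by simp
  moreover have "\<exists>!x. x \<in> A \<and> half_turns (class_rep C) = 2 * (3 * fst x) \<and>
      positive_turns (class_rep C) = 3 * (2 * fst (snd x)) \<and>
      negative_turns (class_rep C) = 3 * (2 * snd (snd x))"
    if "C \<in> {C \<in> W1 g. 6 dvd class_order C}" for C
    using class_genus(4)[of C] that unfolding A by fastforce
  ultimately have "(\<Sum>x\<in>A. \<Sum>C | C \<in> {C \<in> W1 g. 6 dvd class_order C} \<and>
      (half_turns (class_rep C) = 2 * (3 * fst x) \<and>
      positive_turns (class_rep C) = 3 * (2 * fst (snd x)) \<and>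
      negative_turns (class_rep C) = 3 * (2 * snd (snd x))).
      1 / real (class_order C)) = (\<Sum>C\<in>{C \<in> W1 g. 6 dvd class_order C}. 1 / real (class_order C))"
    by (rule sum_by_key)
  then show ?thesis by (simp add: m6_def mass_def W6_eq A_def conj_assoc case_prod_beta)
qed

end

theorem theorem1p2:
  fixes g :: nat
  assumes "g \<ge> 1"
  shows "real (M 1 g) = m1 g + m2 g + 2 * m3 g + 2 * m6 g
       \<and> real (M 2 g) = 2 * m2 g + 4 * m6 g
       \<and> real (M 3 g) = 3 * m3 g + 3 * m6 g
       \<and> real (M 6 g) = 6 * m6 g
       \<and> (\<forall>d::nat. d \<ge> 1 \<longrightarrow> \<not> d dvd 6 \<longrightarrow> M d g = 0)"
proof -
  define ord where "ord C = order (wicks_Aut (class_rep C))" for C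
  \<comment> \<open>The contribution of \<open>C\<close> to the mass of the classes whose order is
    divisible by \<open>d\<close>.\<close>
  define share where "share d C = (if d dvd ord C then 1 / real (ord C) else 0)" for d C
  note fin = finite_W1[OF assms]
  have ord: "ord C \<in> {1, 2, 3, 6}" if "C \<in> W1 g" for C
    unfolding ord_def using class_genus(1)[OF assms that] .
  have M: "real (M d g) = (\<Sum>C\<in>W1 g. if d dvd ord C then 1 else 0)" for d
    unfolding M_eq[OF assms] ord_def using fin by (simp add: sum.inter_filter[symmetric])
  have m: "m1 g = (\<Sum>C\<in>W1 g. share 1 C)" "m2 g = (\<Sum>C\<in>W1 g. share 2 C)"
    "m3 g = (\<Sum>C\<in>W1 g. share 3 C)" "m6 g = (\<Sum>C\<in>W1 g. share 6 C)"
    unfolding m2_eq[OF assms] m3_eq[OF assms] m6_eq[OF assms] share_def ord_def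
    using fin by (simp_all add: sum.inter_filter[symmetric] m1_def mass_def)
  \<comment> \<open>For orders 1, 2, 3 and 6 the summands on the right are \<open>1\<close>,
    \<open>1/2 + 1/2\<close>, \<open>1/3 + 2/3\<close> and \<open>1/6 + 1/6 + 2/6 + 2/6\<close>. The
    next three identities are checked in the same way.\<close>
  have "real (M 1 g) = m1 g + m2 g + 2 * m3 g + 2 * m6 g"
    unfolding M m sum_distrib_left sum.distrib[symmetric]
    by (rule sum.cong) (use ord in \<open>force simp: share_def\<close>)+
  moreover have "real (M 2 g) = 2 * m2 g + 4 * m6 g"
    unfolding M m sum_distrib_left sum.distrib[symmetric]
    by (rule sum.cong) (use ord in \<open>force simp: share_def\<close>)+
  moreover have "real (M 3 g) = 3 * m3 g + 3 * m6 g"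
    unfolding M m sum_distrib_left sum.distrib[symmetric]
    by (rule sum.cong) (use ord in \<open>force simp: share_def\<close>)+
  moreover have "real (M 6 g) = 6 * m6 g"
    unfolding M m sum_distrib_left sum.distrib[symmetric]
    by (rule sum.cong) (use ord in \<open>force simp: share_def\<close>)+
  moreover have "M d g = 0" if "\<not> d dvd 6" for d
  proof -
    have "\<not> d dvd ord C" if C: "C \<in> W1 g" for C
    proof
      assume "d dvd ord C"
      moreover have "ord C dvd 6" using ord[OF C] by auto
      ultimately show False using \<open>\<not> d dvd 6\<close> dvd_trans by blast
    qed
    then have "real (M d g) = 0" unfolding M by (intro sum.neutral) simp
    then show ?thesis by simp
  qed
  ultimately show ?thesis by blast
qed

end
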